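(* Let $1\le n<\omega$ and $\aleph_0\le\kappa\le 2^{\aleph_0}$, and let $\mathcal{H}$ be a set of algebraic hypergraphs with vertex set $\mathbb{R}^n$ such that $|\mathcal{H}|\le\kappa$ and $\chi(H)\le\kappa$ for every $H\in\mathcal{H}$. Then there is a map $\varphi:\mathbb{R}^n\to\kappa$ that is a proper $\kappa$-coloring of every $H\in\mathcal{H}$.
   Context: For $2\le k<\omega$, a $k$-hypergraph is a pair $(V,E)$ with $E$ a set of $k$-element subsets of $V$. A $k$-hypergraph is algebraic if there are $n<\omega$ and a real polynomial $p(x_0,\dots,x_{k-1})$ (each $x_i$ an $n$-tuple of variables) such that $V=\mathbb{R}^n$ and $E$ is the set of $k$-element sets $\{a_0,\dots,a_{k-1}\}\subseteq\mathbb{R}^n$ (for some enumeration of its elements) with $p(a_0,\dots,a_{k-1})=0$. Different members of $\mathcal{H}$ may have different uniformities $k$. A coloring $\varphi:V\to C$ is proper for $(V,E)$ if for every edge $\{a_0,\dots,a_{k-1}\}\in E$ there are $i<j<k$ with $\varphi(a_i)\ne\varphi(a_j)$; $\chi(H)$ is the least cardinal $\kappa$ such that $H$ has a proper $\kappa$-coloring. *)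

theory Defs
  imports "HOL-Analysis.Analysis"
begin

inductive real_polyfun :: "'v set \<Rightarrow> (('v \<Rightarrow> real) \<Rightarrow> real) \<Rightarrow> bool"
  for V :: "'v set" where
  const: "real_polyfun V (\<lambda>_. c)"
| var: "v \<in> V \<Longrightarrow> real_polyfun V (\<lambda>x. x v)"
| add: "real_polyfun V p \<Longrightarrow> real_polyfun V q \<Longrightarrow> real_polyfun V (\<lambda>x. p x + q x)"
| mult: "real_polyfun V p \<Longrightarrow> real_polyfun V q \<Longrightarrow> real_polyfun V (\<lambda>x. p x * q x)"

text \<open>A hypergraph with vertex set real^'n is given by its edge set E.
  It is an algebraic k-hypergraph (for some k \<ge> 2) if there is a real polynomial p in the
  variables x_(i,j), i < k, j a coordinate, such that the edges are exactly the sets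
  {a_0,...,a_(k-1)} of k distinct points with p(a_0,...,a_(k-1)) = 0.\<close>
definition algebraic_hypergraph :: "(real^'a::finite) set set \<Rightarrow> bool" where
  "algebraic_hypergraph E \<longleftrightarrow>
     (\<exists>k p. 2 \<le> k \<and> real_polyfun ({..<k} \<times> (UNIV :: 'a set)) p \<and>
        E = {S. \<exists>a :: nat \<Rightarrow> real^'a. inj_on a {..<k} \<and> S = a ` {..<k} \<and>
                  p (\<lambda>(i, j). a i $ j) = 0})"

definition proper_coloring :: "('v \<Rightarrow> 'c) \<Rightarrow> 'v set set \<Rightarrow> bool" where
  "proper_coloring \<phi> E \<longleftrightarrow> (\<forall>e\<in>E. \<exists>x\<in>e. \<exists>y\<in>e. \<phi> x \<noteq> \<phi> y)"

end

(* Adjoin to the rationals the coefficients of all polynomials involved, obtaining a set F of at most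
   |K| reals, and fix a transcendence basis T of the reals over F. Every point x is f(t) for a tuple t of
   distinct elements of T of minimal length, where each coordinate of f is the unique simple root in a
   rational disc of a polynomial over F, with parameters in a rational polydisc. The colour of x records
   these data (at most |K| possibilities) and a Kuratowski-Sierpinski type colour of t: if T has at most
   the n-th successor of |K| elements, that colour names at most n coordinates which determine t among
   the tuples of the same colour; if T is larger, every K-colouring of the n+1 dimensional power of T
   is constant on some large finite grid.

   A monochromatic edge gives a polynomial relation between values of one and the same f at
   algebraically independent elements. It persists on the whole polydisc by analytic continuation, so
   the coordinates that are not named can be made constant and the named ones can be moved into a grid
   on which a given proper colouring of the hypergraph is constant. The points stay distinct because
   f depends on each of its variables, and this contradicts properness. *)

theory Submission
  imports Defs "HOL-Complex_Analysis.Complex_Analysis"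
begin

section \<open>Tuples and grids in sets of bounded cardinality\<close>

unbundle cardinal_syntax

text \<open>The given colouring of a hypergraph is an arbitrary function, so only a combinatorial
  grid can control it, and grids are limited in dimension by the size of \<open>T\<close>. The two
  bounds fit exactly: for the least \<open>N\<close> such that \<open>T\<close> has at most the
  \<open>N\<close>-th successor of \<open>|K|\<close> elements, at most \<open>N\<close> coordinates
  have to be named, and minimality of \<open>N\<close> provides grids of dimension up to
  \<open>N\<close>.

  An analytic function that vanishes at one point need not vanish near it. Here it does, because it
  satisfies a polynomial equation whose coefficients are polynomials over \<open>F\<close> in
  independent elements: each coefficient is identically zero or nonzero at that point, and the
  lowest nonzero one forces the function to vanish nearby. Complex parameters make the identity
  theorem available along the line joining two points of a polydisc; conjugation brings the values
  at real parameters back to the reals.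

  Elements of a grid may lie anywhere on the real line. Rational translations, harmless for
  independence over \<open>F\<close>, carry them into the discs in which the functions are
  defined.\<close>

lemma lepoll_iff_ordLeq: "A \<lesssim> B \<longleftrightarrow> |A| \<le>o |B|"
  unfolding lepoll_def by (rule card_of_ordLeq)

lemma UN_lepoll_infinite:
  assumes "infinite K" "I \<lesssim> K" "\<And>i. i \<in> I \<Longrightarrow> A i \<lesssim> K"
  shows "(\<Union>i\<in>I. A i) \<lesssim> K"
  using assms card_of_UNION_ordLeq_infinite[of K I A] by (simp add: lepoll_iff_ordLeq)

lemma Times_lepoll_infinite:
  assumes "infinite K" "A \<lesssim> K" "B \<lesssim> K"
  shows "A \<times> B \<lesssim> K"
  using assms card_of_Sigma_ordLeq_infinite[of K A "\<lambda>_. B"] by (simp add: lepoll_iff_ordLeq)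

lemma countable_lepoll_infinite:
  assumes "infinite K" "countable A"
  shows "A \<lesssim> K"
proof -
  have "A \<lesssim> (UNIV :: nat set)"
    using assms(2) by (auto simp: countable_def lepoll_def)
  then show ?thesis
    by (rule lepoll_trans) (use assms(1) in \<open>simp add: infinite_le_lepoll\<close>)
qed

lemma Un_lepoll_infinite:
  assumes "infinite K" "A \<lesssim> K" "B \<lesssim> K"
  shows "A \<union> B \<lesssim> K"
proof -
  have "A \<union> B = (\<Union>b\<in>UNIV. if b then A else B)" by (auto simp: UNIV_bool)
  moreover have "(\<Union>b\<in>UNIV. if b then A else B) \<lesssim> K"
    by (rule UN_lepoll_infinite) (use assms in \<open>auto intro: countable_lepoll_infinite\<close>)
  ultimately show ?thesis by simp
qed

lemma lists_lepoll_infinite: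
  assumes K: "infinite K" and A: "A \<lesssim> K"
  shows "lists A \<lesssim> K"
proof -
  have *: "{xs \<in> lists A. length xs = n} \<lesssim> K" for n
  proof (induction n)
    case 0
    have "{xs \<in> lists A. length xs = 0} = {[]}" by auto
    then show ?case using K countable_lepoll_infinite by (metis countable_empty countable_insert)
  next
    case (Suc n)
    have "{xs \<in> lists A. length xs = Suc n}
        \<subseteq> (\<lambda>(x, xs). x # xs) ` (A \<times> {xs \<in> lists A. length xs = n})"
      by (auto simp: length_Suc_conv image_iff)
    then show ?case
      by (rule lepoll_trans[OF subset_image_lepoll Times_lepoll_infinite[OF K A Suc]])
  qed
  have "lists A = (\<Union>n. {xs \<in> lists A. length xs = n})" by auto
  moreover have "(\<Union>n. {xs \<in> lists A. length xs = n}) \<lesssim> K"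
    by (rule UN_lepoll_infinite[OF K _ *]) (use K in \<open>simp add: infinite_le_lepoll\<close>)
  ultimately show ?thesis by (simp only:)
qed

lemma finite_subsets_lepoll_infinite:
  assumes "infinite K" "A \<lesssim> K"
  shows "{X. finite X \<and> X \<subseteq> A} \<lesssim> K"
proof -
  have "{X. finite X \<and> X \<subseteq> A} \<subseteq> set ` lists A"
  proof
    fix X assume "X \<in> {X. finite X \<and> X \<subseteq> A}"
    then have X: "finite X" "X \<subseteq> A" by auto
    obtain xs where "set xs = X" using finite_list[OF X(1)] by blast
    with X(2) show "X \<in> set ` lists A" by (intro image_eqI[of _ _ xs]) auto
  qed
  then show ?thesis
    by (rule lepoll_trans[OF subset_image_lepoll lists_lepoll_infinite[OF assms]])
qed

lemma finite_funs_lepoll_infinite: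
  assumes "infinite K" "A \<lesssim> K"
  shows "{f :: 'i :: finite \<Rightarrow> 'a. range f \<subseteq> A} \<lesssim> K"
proof -
  obtain xs where xs: "set xs = (UNIV :: 'i set)" using finite_list[OF finite] by blast
  have "inj_on (\<lambda>f. map f xs) {f. range f \<subseteq> A}"
  proof (rule inj_onI)
    fix f g assume "map f xs = map g xs"
    then have "\<forall>x\<in>set xs. f x = g x" by (simp only: map_eq_conv)
    then show "f = g" unfolding xs by auto
  qed
  moreover have "(\<lambda>f. map f xs) ` {f. range f \<subseteq> A} \<subseteq> lists A" by (auto simp: image_subset_iff)
  ultimately have "{f :: 'i \<Rightarrow> 'a. range f \<subseteq> A} \<lesssim> lists A"
    unfolding lepoll_def by blast
  then show ?thesis by (rule lepoll_trans[OF _ lists_lepoll_infinite[OF assms]])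
qed

section \<open>Successor cardinals, determining colourings and homogeneous grids\<close>

lemma infinite_fibre:
  assumes X: "infinite X" and C: "\<not> X \<lesssim> C" "infinite C" and f: "f ` X \<subseteq> C"
  obtains c where "c \<in> C" "infinite {x \<in> X. f x = c}"
proof (rule ccontr)
  assume "\<not> thesis"
  with that have fin: "finite {x \<in> X. f x = c}" if "c \<in> C" for c using that by blast
  have "X = (\<Union>c\<in>C. {x \<in> X. f x = c})" using f by auto
  moreover have "(\<Union>c\<in>C. {x \<in> X. f x = c}) \<lesssim> C"
    by (rule UN_lepoll_infinite)
      (use C fin in \<open>auto intro: countable_lepoll_infinite countable_finite\<close>)
  ultimately show False using C by simp
qed

text \<open>\<open>small K n X\<close> says \<open>|X|\<close> is at most the \<open>n\<close>-th successor cardinal of \<open>|K|\<close>, phrased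
  through initial segments because iterating \<open>cardSuc\<close> would change the type at every step.\<close>

primrec small :: "'c set \<Rightarrow> nat \<Rightarrow> 'a set \<Rightarrow> bool" where
  "small K 0 X \<longleftrightarrow> X \<lesssim> K"
| "small K (Suc n) X \<longleftrightarrow>
     (\<exists>r. (\<forall>Y. finite Y \<and> Y \<noteq> {} \<and> Y \<subseteq> X \<longrightarrow> (\<exists>b\<in>Y. \<forall>y\<in>Y. (y, b) \<in> r)) \<and>
          (\<forall>x\<in>X. small K n {y \<in> X. (y, x) \<in> r}))"

lemma well_order_finite_max:
  assumes r: "Well_order r" "Field r = X" and Y: "finite Y" "Y \<noteq> {}" "Y \<subseteq> X"
  shows "\<exists>b\<in>Y. \<forall>y\<in>Y. (y, b) \<in> r"
  using Y
proof (induction Y rule: finite_ne_induct)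
  case (singleton x)
  have "refl_on X r"
    using r by (auto simp: well_order_on_def linear_order_on_def partial_order_on_def preorder_on_def)
  with singleton show ?case by (auto simp: refl_on_def)
next
  case (insert x Y)
  then obtain b where b: "b \<in> Y" "\<forall>y\<in>Y. (y, b) \<in> r" by auto
  have rf: "refl_on X r" "trans r" "total_on X r"
    using r by (auto simp: well_order_on_def linear_order_on_def partial_order_on_def preorder_on_def)
  have bX: "b \<in> X" "x \<in> X" using insert b by auto
  then have "(x, b) \<in> r \<or> (b, x) \<in> r" using rf by (cases "x = b") (auto simp: total_on_def refl_on_def)
  then show ?case
  proof
    assume "(x, b) \<in> r" then show ?thesis using b by auto
  next
    assume "(b, x) \<in> r"
    then have "\<forall>y\<in>insert x Y. (y, x) \<in> r"
      using b rf bX by (auto simp: refl_on_def dest: transD)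
    then show ?thesis by auto
  qed
qed

text \<open>Initial segments are no larger than the whole set, so the bound \<open>K\<close>
  survives every stage of the recursion. The contrapositive is what the grid lemma uses: a set that
  fails \<open>small K n\<close> for some \<open>n\<close> is larger than \<open>K\<close>.\<close>

lemma lepoll_imp_small: "X \<lesssim> K \<Longrightarrow> small K n X"
proof (induction n arbitrary: X)
  case (Suc n)
  have "Well_order |X|" "Field |X| = X" by (rule card_of_Well_order, rule Field_card_of)
  then have "\<forall>Y. finite Y \<and> Y \<noteq> {} \<and> Y \<subseteq> X \<longrightarrow> (\<exists>b\<in>Y. \<forall>y\<in>Y. (y, b) \<in> |X| )"
    using well_order_finite_max by blast
  moreover have "\<forall>x\<in>X. small K n {y \<in> X. (y, x) \<in> |X| }"
  proof
    fix x
    have "{y \<in> X. (y, x) \<in> |X| } \<lesssim> X" by (rule subset_imp_lepoll) blast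
    then show "small K n {y \<in> X. (y, x) \<in> |X| }" using Suc.prems by (intro Suc.IH) (rule lepoll_trans)
  qed
  ultimately show ?case unfolding small.simps by blast
qed simp

text \<open>The cardinal well-order of \<open>X\<close> is tried as the witness for
  \<open>small\<close>. Its segments are strictly smaller than \<open>X\<close>, so the segment at
  which the witness fails is still large for \<open>n\<close> and yet too small to contain a copy of
  \<open>X\<close>; the second property drives a pigeonhole argument later.\<close>

lemma not_small_Suc_segment:
  assumes "\<not> small K (Suc n) X" and inf: "infinite X"
  obtains Y where "Y \<subseteq> X" "\<not> small K n Y" "\<not> X \<lesssim> Y"
proof -
  have W: "Well_order |X|" "Field |X| = X" by (rule card_of_Well_order, rule Field_card_of)
  then have "\<forall>Y. finite Y \<and> Y \<noteq> {} \<and> Y \<subseteq> X \<longrightarrow> (\<exists>b\<in>Y. \<forall>y\<in>Y. (y, b) \<in> |X| )"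
    using well_order_finite_max by blast
  with assms obtain x where x: "x \<in> X" "\<not> small K n {y \<in> X. (y, x) \<in> |X| }"
    unfolding small.simps by blast
  have lt: "|underS |X| x| <o |X|"
    using card_of_underS[OF card_of_Card_order, of x X] x(1) by (simp only: W(2))
  have sub: "{y \<in> X. (y, x) \<in> |X| } \<subseteq> insert x (underS |X| x)"
    by (auto simp: underS_def)
  have "\<not> X \<lesssim> {y \<in> X. (y, x) \<in> |X| }"
  proof
    assume "X \<lesssim> {y \<in> X. (y, x) \<in> |X| }"
    then have le: "X \<lesssim> insert x (underS |X| x)"
      by (rule lepoll_trans[OF _ subset_imp_lepoll[OF sub]])
    then have "infinite (underS |X| x)"
      using inf inj_on_finite by (metis lepoll_def finite_insert)
    then have "X \<lesssim> underS |X| x"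
      by (rule lepoll_trans2[OF le infinite_insert_eqpoll])
    then show False
      using lt not_ordLess_ordLeq by (auto simp: lepoll_iff_ordLeq)
  qed
  with x show ?thesis by (intro that[of "{y \<in> X. (y, x) \<in> |X| }"]) auto
qed

text \<open>The coordinates named by a colour are found by taking the largest one and recursing inside the
  initial segment it spans.\<close>

lemma small_determining_coloring:
  fixes K :: "'c set" and X :: "'a set"
  assumes K: "infinite K" and sm: "small K n X"
  shows "\<exists>\<phi>::(nat \<Rightarrow> 'a) \<Rightarrow> 'c. \<exists>J.
     (\<forall>x. (\<forall>l<d. x l \<in> X) \<longrightarrow> \<phi> x \<in> K) \<and>
     (\<forall>c. J c \<subseteq> {..<d} \<and> card (J c) \<le> n) \<and>
     (\<forall>x y. (\<forall>l<d. x l \<in> X) \<longrightarrow> (\<forall>l<d. y l \<in> X) \<longrightarrow> \<phi> x = \<phi> y \<longrightarrow>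
        (\<forall>l\<in>J (\<phi> x). x l = y l) \<longrightarrow> (\<forall>l<d. x l = y l))"
  using sm
proof (induction n arbitrary: X)
  case 0
  \<comment> \<open>There are at most \<open>|K|\<close> tuples, so the colour can be the tuple
    itself and no coordinate needs naming.\<close>
  then have "lists X \<lesssim> K" using lists_lepoll_infinite[OF K] by simp
  then obtain h where h: "inj_on h (lists X)" "h ` lists X \<subseteq> K" by (auto simp: lepoll_def)
  have mem: "map x [0..<d] \<in> lists X" if "\<forall>l<d. x l \<in> X" for x using that by auto
  show ?case
  proof (intro exI[of _ "\<lambda>x. h (map x [0..<d])"] exI[of _ "\<lambda>_. {}"] conjI allI impI)
    fix x y l assume "\<forall>l<d. x l \<in> X" "\<forall>l<d. y l \<in> X" "h (map x [0..<d]) = h (map y [0..<d])" "l < d"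
    then have "map x [0..<d] = map y [0..<d]" using h mem by (meson inj_onD)
    then show "x l = y l" using \<open>l < d\<close> by simp
  qed (use h mem in auto)
next
  case (Suc n)
  show ?case
  proof (cases "d = 0")
    case True
    \<comment> \<open>An empty tuple has no largest entry, so this case is split off.\<close>
    from K obtain c where "c \<in> K" by fastforce
    with True show ?thesis by (intro exI[of _ "\<lambda>_. c"] exI[of _ "\<lambda>_. {}"]) auto
  next
    case False
    from Suc.prems obtain r where
      mx: "\<And>Y. finite Y \<Longrightarrow> Y \<noteq> {} \<Longrightarrow> Y \<subseteq> X \<Longrightarrow> (\<exists>b\<in>Y. \<forall>y\<in>Y. (y, b) \<in> r)"
      and seg: "\<And>x. x \<in> X \<Longrightarrow> small K n {y \<in> X. (y, x) \<in> r}"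
      by auto
    define X' where "X' b = {y \<in> X. (y, b) \<in> r}" for b
    define P where "P Y \<phi> J \<longleftrightarrow>
     (\<forall>x. (\<forall>l<d. x l \<in> Y) \<longrightarrow> \<phi> x \<in> K) \<and>
     (\<forall>c. J c \<subseteq> {..<d} \<and> card (J c) \<le> n) \<and>
     (\<forall>x y. (\<forall>l<d. x l \<in> Y) \<longrightarrow> (\<forall>l<d. y l \<in> Y) \<longrightarrow> \<phi> x = \<phi> y \<longrightarrow>
        (\<forall>l\<in>J (\<phi> x). x l = y l) \<longrightarrow> (\<forall>l<d. x l = y l))" for Y :: "'a set" and \<phi> :: "(nat \<Rightarrow> 'a) \<Rightarrow> 'c" and J
    have "\<forall>b\<in>X. \<exists>\<phi> J. P (X' b) \<phi> J"
      unfolding P_def X'_def by (intro ballI Suc.IH seg)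
    from bchoice[OF this] obtain \<phi> where "\<forall>b\<in>X. \<exists>J. P (X' b) (\<phi> b) J" ..
    from bchoice[OF this] obtain J where IH: "\<forall>b\<in>X. P (X' b) (\<phi> b) (J b)" ..
    have IH1: "\<phi> b x \<in> K" if "b \<in> X" "\<forall>l<d. x l \<in> X' b" for b x
      using IH that unfolding P_def by blast
    have IH2: "J b c \<subseteq> {..<d}" "card (J b c) \<le> n" if "b \<in> X" for b c
      using IH that unfolding P_def by blast+
    have IH3: "x l = y l"
      if "b \<in> X" "\<forall>l<d. x l \<in> X' b" "\<forall>l<d. y l \<in> X' b" "\<phi> b x = \<phi> b y"
        "\<forall>l\<in>J b (\<phi> b x). x l = y l" "l < d" for b x y l
      using IH that unfolding P_def by blast
    have "\<forall>x. \<exists>j. (\<forall>l<d. x l \<in> X) \<longrightarrow> j < d \<and> (\<forall>l<d. (x l, x j) \<in> r)"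
    proof
      fix x
      show "\<exists>j. (\<forall>l<d. x l \<in> X) \<longrightarrow> j < d \<and> (\<forall>l<d. (x l, x j) \<in> r)"
      proof (cases "\<forall>l<d. x l \<in> X")
        case True
        then have "\<exists>b\<in>x ` {..<d}. \<forall>y\<in>x ` {..<d}. (y, b) \<in> r"
          using False by (intro mx) auto
        then show ?thesis by auto
      qed auto
    qed
    then obtain top where top: "\<And>x. (\<forall>l<d. x l \<in> X) \<Longrightarrow> top x < d \<and> (\<forall>l<d. (x l, x (top x)) \<in> r)"
      by metis
    let ?C = "{..<d} \<times> Pow {..<d} \<times> K"
    have "{..<d} \<lesssim> K" "Pow {..<d} \<lesssim> K"
      by (intro countable_lepoll_infinite[OF K countable_finite]; simp)+
    then have "?C \<lesssim> K" by (intro Times_lepoll_infinite[OF K] lepoll_refl)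
    then obtain h where h: "inj_on h ?C" "h ` ?C \<subseteq> K" by (auto simp: lepoll_def)
    \<comment> \<open>All entries of \<open>x\<close> lie in the segment below the largest entry
      \<open>b = x (top x)\<close>, where the inductive colouring \<open>\<phi> b\<close> applies.
      The set named by \<open>\<phi> b\<close> goes into the colour itself, because
      \<open>J'\<close> sees only the colour and not \<open>b\<close>.\<close>
    define col where "col x = (top x, J (x (top x)) (\<phi> (x (top x)) x), \<phi> (x (top x)) x)" for x
    have in': "x l \<in> X' (x (top x))" if "\<forall>l<d. x l \<in> X" "l < d" for x l
      using that top[of x] by (auto simp: X'_def)
    have col: "col x \<in> ?C" if "\<forall>l<d. x l \<in> X" for x
      using that top[OF that] in'[OF that] IH1[of "x (top x)" x] IH2[of "x (top x)"]
      by (auto simp: col_def)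
    \<comment> \<open>The size bound is demanded for every \<open>c\<close>, also for those that are
      not the colour of a tuple; hence the default \<open>{}\<close> and the test
      \<open>card J0 \<le> n\<close>, which succeeds on actual colours.\<close>
    define J' where "J' c = (if c \<in> h ` ?C then
        (case the_inv_into ?C h c of (j, J0, _) \<Rightarrow> if card J0 \<le> n then insert j J0 else {}) else {})" for c
    have J': "J' (h (col x)) = insert (top x) (J (x (top x)) (\<phi> (x (top x)) x))"
      if "\<forall>l<d. x l \<in> X" for x
      using col[OF that] h(1) IH2[of "x (top x)"] top[OF that] that
      by (simp add: J'_def the_inv_into_f_f col_def)
    show ?thesis
    proof (intro exI[of _ "\<lambda>x. h (col x)"] exI[of _ J'] conjI allI impI)
      fix x assume "\<forall>l<d. x l \<in> X"
      then show "h (col x) \<in> K" using col h by blast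
    next
      fix c
      show "J' c \<subseteq> {..<d}" "card (J' c) \<le> Suc n"
        using h(1) by (auto simp: J'_def the_inv_into_f_f card_insert_if finite_subset[of _ "{..<d}"]
            split: prod.splits if_splits)
    next
      fix x y l
      assume x: "\<forall>l<d. x l \<in> X" and y: "\<forall>l<d. y l \<in> X" and eq: "h (col x) = h (col y)"
        and ag: "\<forall>l\<in>J' (h (col x)). x l = y l" and l: "l < d"
      have ceq: "col x = col y" using inj_onD[OF h(1) eq] col x y by blast
      have t1: "top x = top y" using ceq unfolding col_def by (rule Pair_inject)
      have "x (top x) = y (top x)" using ag J'[OF x] by blast
      then have t2: "x (top x) = y (top y)" using t1 by (simp only:)
      define b where "b = x (top x)"
      have b: "b \<in> X" using top[OF x] x by (auto simp: b_def)
      have b': "b = y (top y)" using t2 by (simp only: b_def)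
      have "\<phi> (x (top x)) x = \<phi> (y (top y)) y" using ceq unfolding col_def by blast
      then have "\<phi> b x = \<phi> b y" by (simp only: b_def[symmetric] b'[symmetric])
      moreover have "\<forall>l\<in>J b (\<phi> b x). x l = y l" using ag J'[OF x] unfolding b_def by blast
      moreover have "\<forall>l<d. x l \<in> X' b" using in'[OF x] unfolding b_def by blast
      moreover have "\<forall>l<d. y l \<in> X' b" using in'[OF y] unfolding b' by blast
      ultimately show "x l = y l" using IH3[OF b] l by blast
    qed
  qed
qed

text \<open>Induction on the dimension. With one coordinate fixed to \<open>a\<close>, the
  hypothesis yields a grid and a colour inside a segment \<open>Y\<close> smaller than
  \<open>X\<close>. There are at most \<open>|Y|\<close> such pairs, so infinitely many
  \<open>a\<close> share one pair, and \<open>r\<close> of these \<open>a\<close> form the new side.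
  The set \<open>Z\<close> and the disjointness of the sides serve to keep entries at different
  positions distinct later on.\<close>

lemma not_small_grid:
  fixes g :: "(nat \<Rightarrow> 'a) \<Rightarrow> 'c" and I :: "nat set" and X :: "'a set"
  assumes K: "infinite K" and ns: "\<not> small K n X" and I: "finite I" "card I = Suc n"
    and Z: "finite Z" and g: "\<And>z. g z \<in> K"
    and ext: "\<And>z z'. (\<forall>l\<in>I. z l = z' l) \<Longrightarrow> g z = g z'"
  shows "\<exists>A. \<exists>c\<in>K. (\<forall>l\<in>I. A l \<subseteq> X - Z \<and> finite (A l) \<and> card (A l) = r) \<and>
     disjoint_family_on A I \<and> (\<forall>z. (\<forall>l\<in>I. z l \<in> A l) \<longrightarrow> g z = c)"
  using ns I Z g ext
proof (induction n arbitrary: X I g Z)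
  case 0
  obtain i where I: "I = {i}"
    using card_1_singletonE[of I] 0(3) by (metis One_nat_def)
  have nX: "\<not> X \<lesssim> K" using 0(1) by simp
  then have "infinite X" using K finite_lepoll_infinite by blast
  moreover have "(\<lambda>x. g (\<lambda>_. x)) ` X \<subseteq> K" using 0(5) by blast
  ultimately obtain c where c: "c \<in> K" "infinite {x \<in> X. g (\<lambda>_. x) = c}"
    using infinite_fibre[OF _ nX K] by blast
  then have "infinite ({x \<in> X. g (\<lambda>_. x) = c} - Z)" using 0(4) by simp
  from infinite_arbitrarily_large[OF this]
  obtain A where A: "finite A" "card A = r" "A \<subseteq> {x \<in> X. g (\<lambda>_. x) = c} - Z" by blast
  have "g z = c" if "z i \<in> A" for z
  proof -
    have "g z = g (\<lambda>_. z i)" by (rule 0(6)) (simp add: I)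
    then show ?thesis using that A by auto
  qed
  then show ?case using A I c
    by (intro exI[of _ "\<lambda>_. A"] bexI[of _ c]) (auto simp: disjoint_family_on_def)
next
  case (Suc n)
  have nX: "\<not> X \<lesssim> K" using Suc.prems(1) lepoll_imp_small by blast
  then have infX: "infinite X" using K finite_lepoll_infinite by blast
  obtain Y where Y: "Y \<subseteq> X" "\<not> small K n Y" "\<not> X \<lesssim> Y"
    using not_small_Suc_segment[OF Suc.prems(1) infX] by blast
  have nY: "\<not> Y \<lesssim> K" using Y lepoll_imp_small by blast
  then have infY: "infinite Y" using K finite_lepoll_infinite by blast
  have KY: "K \<lesssim> Y"
    using nY ordLeq_total[of "|K|" "|Y|"] by (auto simp: lepoll_iff_ordLeq card_of_Well_order)
  have "I \<noteq> {}" using Suc.prems(3) by auto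
  then obtain i where i: "i \<in> I" by blast
  define I' where "I' = I - {i}"
  have I': "finite I'" "card I' = Suc n" "I = insert i I'" "i \<notin> I'"
    using Suc.prems(2,3) i by (auto simp: I'_def)
  have "\<forall>a. \<exists>A. \<exists>c\<in>K. (\<forall>l\<in>I'. A l \<subseteq> Y - Z \<and> finite (A l) \<and> card (A l) = r) \<and>
     disjoint_family_on A I' \<and> (\<forall>z. (\<forall>l\<in>I'. z l \<in> A l) \<longrightarrow> g (z(i := a)) = c)"
  proof (intro allI, rule Suc.IH[OF Y(2) I'(1,2) Suc.prems(4)])
    fix a :: 'a and z z' :: "nat \<Rightarrow> 'a" assume "\<forall>l\<in>I'. z l = z' l"
    then have "\<forall>l\<in>I. (z(i := a)) l = (z'(i := a)) l" using I' by auto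
    then show "g (z(i := a)) = g (z'(i := a))" by (rule Suc.prems(6))
  qed (rule Suc.prems(5))
  from choice[OF this] obtain A where
    "\<forall>a. \<exists>c\<in>K. (\<forall>l\<in>I'. A a l \<subseteq> Y - Z \<and> finite (A a l) \<and> card (A a l) = r) \<and>
     disjoint_family_on (A a) I' \<and> (\<forall>z. (\<forall>l\<in>I'. z l \<in> A a l) \<longrightarrow> g (z(i := a)) = c)" ..
  then obtain c where A0: "\<forall>a. c a \<in> K \<and> (\<forall>l\<in>I'. A a l \<subseteq> Y - Z \<and> finite (A a l) \<and> card (A a l) = r) \<and>
     disjoint_family_on (A a) I' \<and> (\<forall>z. (\<forall>l\<in>I'. z l \<in> A a l) \<longrightarrow> g (z(i := a)) = c a)"
    unfolding Bex_def by (rule choice[THEN exE])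
  have A: "\<And>a l. l \<in> I' \<Longrightarrow> A a l \<subseteq> Y - Z \<and> finite (A a l) \<and> card (A a l) = r"
      "\<And>a. disjoint_family_on (A a) I'"
      "\<And>a z. (\<forall>l\<in>I'. z l \<in> A a l) \<Longrightarrow> g (z(i := a)) = c a" "\<And>a. c a \<in> K"
    using A0 by blast+
  \<comment> \<open>The graph \<open>Sigma I' (A a)\<close> forgets the values of \<open>A a\<close>
    outside \<open>I'\<close> and is a finite subset of a set of size \<open>|Y|\<close>, so such
    graphs can be counted.\<close>
  define G where "G a = (Sigma I' (A a), c a)" for a
  define C where "C = {W. finite W \<and> W \<subseteq> (UNIV :: nat set) \<times> Y} \<times> K"
  have "(UNIV :: nat set) \<lesssim> Y" using infY by (simp add: infinite_le_lepoll)
  then have "{W. finite W \<and> W \<subseteq> (UNIV :: nat set) \<times> Y} \<lesssim> Y"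
    by (intro finite_subsets_lepoll_infinite infY Times_lepoll_infinite lepoll_refl)
  then have CY: "C \<lesssim> Y"
    unfolding C_def by (rule Times_lepoll_infinite[OF infY _ KY])
  have nXC: "\<not> X \<lesssim> C"
  proof
    assume "X \<lesssim> C"
    then have "X \<lesssim> Y" using CY by (rule lepoll_trans)
    with Y(3) show False ..
  qed
  have GC: "G ` X \<subseteq> C"
  proof
    fix w assume "w \<in> G ` X"
    then obtain a where w: "w = G a" by blast
    have "finite (Sigma I' (A a))" using A(1) I'(1) by (intro finite_SigmaI) blast+
    moreover have "Sigma I' (A a) \<subseteq> UNIV \<times> Y" using A(1) by blast
    ultimately show "w \<in> C" using A(4) by (simp add: w G_def C_def)
  qed
  have "{{}} \<times> K \<subseteq> C" by (auto simp: C_def)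
  then have infC: "infinite C" using K finite_cartesian_productD2 infinite_super by blast
  obtain w where w: "infinite {x \<in> X. G x = w}"
    by (rule infinite_fibre[OF infX nXC infC GC])
  then have "{x \<in> X. G x = w} \<noteq> {}" by force
  then obtain a0 where a0: "a0 \<in> X" "G a0 = w" by blast
  define A0 where "A0 = A a0"
  have fA0: "finite (\<Union>l\<in>I'. A0 l)" using A(1) I' by (auto simp: A0_def)
  then have "infinite ({x \<in> X. G x = w} - (Z \<union> (\<Union>l\<in>I'. A0 l)))" using w Suc.prems(4) by simp
  from infinite_arbitrarily_large[OF this]
  obtain B where B: "finite B" "card B = r" "B \<subseteq> {x \<in> X. G x = w} - (Z \<union> (\<Union>l\<in>I'. A0 l))" by blast
  have same: "A a l = A0 l" "c a = c a0" if "a \<in> B" "l \<in> I'" for a l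
  proof -
    have "G a = G a0" using that(1) B(3) a0(2) by blast
    then have "(Sigma I' (A a), c a) = (Sigma I' (A a0), c a0)" unfolding G_def .
    then have eq: "Sigma I' (A a) = Sigma I' (A a0)" "c a = c a0" by blast+
    show "c a = c a0" by (rule eq)
    have "A a l = Sigma I' (A a) `` {l}" using that(2) by blast
    also have "\<dots> = Sigma I' (A a0) `` {l}" by (simp only: eq(1))
    also have "\<dots> = A a0 l" using that(2) by blast
    finally show "A a l = A0 l" by (simp only: A0_def)
  qed
  obtain l0 where l0: "l0 \<in> I'" using I'(2) by (metis card.empty ex_in_conv nat.distinct(1))
  let ?A = "A0(i := B)"
  have "\<forall>l\<in>I. ?A l \<subseteq> X - Z \<and> finite (?A l) \<and> card (?A l) = r"
  proof
    fix l assume "l \<in> I"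
    then consider "l = i" | "l \<in> I'" "l \<noteq> i" using I' by blast
    then show "?A l \<subseteq> X - Z \<and> finite (?A l) \<and> card (?A l) = r"
    proof cases
      case 1
      then show ?thesis using B by auto
    next
      case 2
      then show ?thesis using A(1)[of l a0] Y(1) by (auto simp: A0_def)
    qed
  qed
  moreover have "disjoint_family_on ?A I"
    unfolding disjoint_family_on_def
  proof (intro ballI impI)
    fix l m assume lm: "l \<in> I" "m \<in> I" "l \<noteq> m"
    have "B \<inter> A0 k = {}" if "k \<in> I'" for k using B(3) that by blast
    moreover have "A0 l \<inter> A0 m = {}" if "l \<in> I'" "m \<in> I'"
      using A(2)[of a0] that lm(3) unfolding disjoint_family_on_def A0_def by blast
    ultimately show "?A l \<inter> ?A m = {}" using lm I'(3) by (auto simp: Int_commute)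
  qed
  moreover have "g z = c a0" if z: "\<forall>l\<in>I. z l \<in> ?A l" for z
  proof -
    have zi: "z i \<in> B" using z i by force
    have "z l \<in> A (z i) l" if "l \<in> I'" for l
    proof -
      have "l \<noteq> i" "l \<in> I" using that I'(3,4) by blast+
      then have "z l \<in> A0 l" using z by auto
      then show ?thesis by (simp only: same(1)[OF zi that])
    qed
    then have "g (z(i := z i)) = c (z i)" by (intro A(3) ballI)
    then show ?thesis by (simp only: same(2)[OF zi l0] fun_upd_triv)
  qed
  ultimately show ?case using A(4)[of a0] by blast
qed

section \<open>Polynomial expressions and transcendence bases\<close>

text \<open>Syntax in place of polynomial functions: the constants of an expression can be collected
  and counted, and a polynomial with real constants can be evaluated at complex points.\<close>

datatype (pvars: 'v) pexpr =
    Cst real | Vr 'v | Ad "'v pexpr" "'v pexpr" | Ml "'v pexpr" "'v pexpr"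

primrec ev :: "('v \<Rightarrow> complex) \<Rightarrow> 'v pexpr \<Rightarrow> complex" where
  "ev u (Cst c) = of_real c"
| "ev u (Vr v) = u v"
| "ev u (Ad a b) = ev u a + ev u b"
| "ev u (Ml a b) = ev u a * ev u b"

primrec csts :: "'v pexpr \<Rightarrow> real set" where
  "csts (Cst c) = {c}"
| "csts (Vr v) = {}"
| "csts (Ad a b) = csts a \<union> csts b"
| "csts (Ml a b) = csts a \<union> csts b"

primrec psubst :: "('v \<Rightarrow> 'w pexpr) \<Rightarrow> 'v pexpr \<Rightarrow> 'w pexpr" where
  "psubst s (Cst c) = Cst c"
| "psubst s (Vr v) = s v"
| "psubst s (Ad a b) = Ad (psubst s a) (psubst s b)"
| "psubst s (Ml a b) = Ml (psubst s a) (psubst s b)"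

primrec pdiff :: "'v \<Rightarrow> 'v pexpr \<Rightarrow> 'v pexpr" where
  "pdiff z (Cst c) = Cst 0"
| "pdiff z (Vr v) = Cst (if v = z then 1 else 0)"
| "pdiff z (Ad a b) = Ad (pdiff z a) (pdiff z b)"
| "pdiff z (Ml a b) = Ad (Ml (pdiff z a) b) (Ml a (pdiff z b))"

primrec upoly :: "'v \<Rightarrow> ('v \<Rightarrow> complex) \<Rightarrow> 'v pexpr \<Rightarrow> complex poly" where
  "upoly z u (Cst c) = [:of_real c:]"
| "upoly z u (Vr v) = (if v = z then [:0, 1:] else [:u v:])"
| "upoly z u (Ad a b) = upoly z u a + upoly z u b"
| "upoly z u (Ml a b) = upoly z u a * upoly z u b"

definition over :: "real set \<Rightarrow> 'v set \<Rightarrow> 'v pexpr set" where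
  "over F V = {e. csts e \<subseteq> F \<and> pvars e \<subseteq> V}"

lemma over_simps [simp]:
  "Cst c \<in> over F V \<longleftrightarrow> c \<in> F"
  "Vr v \<in> over F V \<longleftrightarrow> v \<in> V"
  "Ad a b \<in> over F V \<longleftrightarrow> a \<in> over F V \<and> b \<in> over F V"
  "Ml a b \<in> over F V \<longleftrightarrow> a \<in> over F V \<and> b \<in> over F V"
  by (auto simp: over_def)

lemma over_mono: "V \<subseteq> V' \<Longrightarrow> e \<in> over F V \<Longrightarrow> e \<in> over F V'"
  by (auto simp: over_def)

lemma finite_pvars [simp]: "finite (pvars e)"
  by (induction e) auto

lemma ev_cong: "e \<in> over F V \<Longrightarrow> (\<And>v. v \<in> V \<Longrightarrow> u v = u' v) \<Longrightarrow> ev u e = ev u' e"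
  by (induction e) auto

lemma ev_psubst: "ev u (psubst s e) = ev (\<lambda>v. ev u (s v)) e"
  by (induction e) auto

lemma psubst_over:
  "e \<in> over F V \<Longrightarrow> (\<And>v. v \<in> V \<Longrightarrow> s v \<in> over F W) \<Longrightarrow> psubst s e \<in> over F W"
  by (induction e) auto

lemma ev_cnj: "ev (\<lambda>v. cnj (u v)) e = cnj (ev u e)"
  by (induction e) auto

lemma pdiff_over: "{0, 1} \<subseteq> F \<Longrightarrow> e \<in> over F V \<Longrightarrow> pdiff z e \<in> over F V"
  by (induction e) auto

lemma poly_upoly: "poly (upoly z u e) y = ev (u(z := y)) e"
  by (induction e) auto

lemma pderiv_upoly: "pderiv (upoly z u e) = upoly z u (pdiff z e)"
  by (induction e) (auto simp: pderiv_add pderiv_mult pderiv_pCons algebra_simps)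

lemma has_field_derivative_ev:
  "((\<lambda>y. ev (u(z := y)) e) has_field_derivative ev (u(z := y)) (pdiff z e)) (at y within S)"
proof -
  have "((\<lambda>y. poly (upoly z u e) y) has_field_derivative poly (pderiv (upoly z u e)) y) (at y within S)"
    using poly_DERIV has_field_derivative_at_within by blast
  then show ?thesis by (simp add: poly_upoly pderiv_upoly)
qed

text \<open>The degree may drop when leading coefficients vanish at \<open>u\<close>. A bound
  uniform in \<open>u\<close> lets the equation of a root be written as a sum of fixed
  length.\<close>

lemma degree_upoly_bounded: "\<exists>D. \<forall>u. degree (upoly z u e) \<le> D"
proof (induction e)
  case (Ad a b)
  then obtain D E where "\<forall>u. degree (upoly z u a) \<le> D" "\<forall>u. degree (upoly z u b) \<le> E" by blast
  then have "\<forall>u. degree (upoly z u (Ad a b)) \<le> max D E"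
    by (auto intro: degree_add_le le_max_iff_disj[THEN iffD2])
  then show ?case ..
next
  case (Ml a b)
  then obtain D E where "\<forall>u. degree (upoly z u a) \<le> D" "\<forall>u. degree (upoly z u b) \<le> E" by blast
  then have "\<forall>u. degree (upoly z u (Ml a b)) \<le> D + E"
    by (auto intro!: order_trans[OF degree_mult_le] add_mono)
  then show ?case ..
qed (auto intro: exI[of _ 1])

lemma over_sum:
  assumes "0 \<in> F" "\<And>i. i \<in> I \<Longrightarrow> \<exists>e\<in>over F V. \<forall>u. ev u e = f i u"
  shows "\<exists>e\<in>over F V. \<forall>u. ev u e = (\<Sum>i\<in>I. f i u)"
proof (cases "finite I")
  case True
  then show ?thesis using assms(2)
  proof (induction I rule: finite_induct)
    case empty
    show ?case using assms(1) by (intro bexI[of _ "Cst 0"]) auto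
  next
    case (insert i I)
    then obtain a b where "a \<in> over F V" "\<forall>u. ev u a = f i u"
      "b \<in> over F V" "\<forall>u. ev u b = (\<Sum>i\<in>I. f i u)" by (metis insert_iff)
    then show ?case using insert by (intro bexI[of _ "Ad a b"]) auto
  qed
next
  case False
  then show ?thesis using assms(1) by (intro bexI[of _ "Cst 0"]) auto
qed

text \<open>This turns the equation of a root into one whose coefficients are polynomial functions
  over \<open>F\<close> of the parameters.\<close>

lemma coeff_upoly_over:
  assumes F: "{0, 1} \<subseteq> F" and e: "e \<in> over F (insert None (Some ` V))"
  shows "\<exists>a\<in>over F V. \<forall>u. ev u a = coeff (upoly None (case_option 0 u) e) m"
  using e
proof (induction e arbitrary: m)
  case (Cst c)
  then show ?case using F by (intro bexI[of _ "Cst (if m = 0 then c else 0)"]) (auto simp: coeff_pCons split: nat.split)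
next
  case (Vr v)
  show ?case
  proof (cases v)
    case None
    then show ?thesis using F
      by (intro bexI[of _ "Cst (if m = 1 then 1 else 0)"]) (auto simp: coeff_pCons split: nat.split)
  next
    case (Some w)
    then show ?thesis using F Vr
      by (intro bexI[of _ "if m = 0 then Vr w else Cst 0"]) (auto simp: coeff_pCons split: nat.split)
  qed
next
  case (Ad a b)
  then obtain a' b' where "a' \<in> over F V" "\<forall>u. ev u a' = coeff (upoly None (case_option 0 u) a) m"
      "b' \<in> over F V" "\<forall>u. ev u b' = coeff (upoly None (case_option 0 u) b) m"
    by (metis over_simps(3))
  then show ?case by (intro bexI[of _ "Ad a' b'"]) auto
next
  case (Ml a b)
  have "\<exists>e\<in>over F V. \<forall>u. ev u e =
     (\<Sum>i\<le>m. coeff (upoly None (case_option 0 u) a) i * coeff (upoly None (case_option 0 u) b) (m - i))"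
  proof (rule over_sum)
    fix i
    obtain a' b' where "a' \<in> over F V" "\<forall>u. ev u a' = coeff (upoly None (case_option 0 u) a) i"
      "b' \<in> over F V" "\<forall>u. ev u b' = coeff (upoly None (case_option 0 u) b) (m - i)"
      using Ml by (metis over_simps(4))
    then show "\<exists>e\<in>over F V. \<forall>u. ev u e =
        coeff (upoly None (case_option 0 u) a) i * coeff (upoly None (case_option 0 u) b) (m - i)"
      by (intro bexI[of _ "Ml a' b'"]) auto
  qed (use F in auto)
  then show ?case by (simp add: coeff_mult)
qed

lemma over_lepoll:
  assumes K: "infinite K" and F: "F \<lesssim> K" and V: "V \<lesssim> K"
  shows "over F V \<lesssim> K"
proof -
  define E where "E = rec_nat {} (\<lambda>_ X. Cst ` F \<union> Vr ` V \<union> (\<lambda>(a, b). Ad a b) ` (X \<times> X)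
     \<union> (\<lambda>(a, b). Ml a b) ` (X \<times> X))"
  have E_simps: "E 0 = {}" "E (Suc n) = Cst ` F \<union> Vr ` V \<union> (\<lambda>(a, b). Ad a b) ` (E n \<times> E n)
     \<union> (\<lambda>(a, b). Ml a b) ` (E n \<times> E n)" for n
    by (simp_all add: E_def)
  have img: "f ` A \<lesssim> K" if "A \<lesssim> K" for f :: "'x \<Rightarrow> 'y" and A
    using that by (rule lepoll_trans[OF image_lepoll])
  have card: "E n \<lesssim> K" for n
  proof (induction n)
    case (Suc n)
    have "E n \<times> E n \<lesssim> K" by (rule Times_lepoll_infinite[OF K Suc Suc])
    then show ?case
      unfolding E_simps by (intro Un_lepoll_infinite[OF K] img F V)
  qed (simp add: E_simps)
  have mono: "E n \<subseteq> E (Suc n)" for n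
  proof (induction n)
    case (Suc n)
    show ?case
      using Suc unfolding E_simps(2)[of n] E_simps(2)[of "Suc n"]
      by (intro Un_mono image_mono Sigma_mono subset_refl) (simp_all only: E_simps(2))
  qed (simp add: E_simps)
  have mono': "n \<le> m \<Longrightarrow> E n \<subseteq> E m" for n m
    using mono by (rule lift_Suc_mono_le)
  have "over F V \<subseteq> (\<Union>n. E n)"
  proof
    fix e assume "e \<in> over F V"
    then show "e \<in> (\<Union>n. E n)"
    proof (induction e)
      case (Cst c) then have "Cst c \<in> E 1" by (simp add: E_simps) then show ?case by blast
    next
      case (Vr v) then have "Vr v \<in> E 1" by (simp add: E_simps) then show ?case by blast
    next
      case (Ad a b)
      then obtain n m where "a \<in> E n" "b \<in> E m" by auto
      then have "a \<in> E (max n m)" "b \<in> E (max n m)" using mono'[of n "max n m"] mono'[of m "max n m"] by auto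
      then have "Ad a b \<in> E (Suc (max n m))" by (auto simp: E_simps)
      then show ?case by blast
    next
      case (Ml a b)
      then obtain n m where "a \<in> E n" "b \<in> E m" by auto
      then have "a \<in> E (max n m)" "b \<in> E (max n m)" using mono'[of n "max n m"] mono'[of m "max n m"] by auto
      then have "Ml a b \<in> E (Suc (max n m))" by (auto simp: E_simps)
      then show ?case by blast
    qed
  qed
  moreover have "(\<Union>n. E n) \<lesssim> K"
    by (rule UN_lepoll_infinite[OF K _ card]) (simp add: countable_lepoll_infinite[OF K])
  ultimately show ?thesis by (rule lepoll_trans[OF subset_imp_lepoll])
qed

lemma real_polyfun_pexpr:
  assumes "real_polyfun V p"
  shows "\<exists>e. pvars e \<subseteq> V \<and> finite (csts e) \<and> (\<forall>x. ev (\<lambda>v. of_real (x v)) e = of_real (p x))"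
  using assms
proof induction
  case (const c)
  show ?case by (intro exI[of _ "Cst c"]) auto
next
  case (var v)
  then show ?case by (intro exI[of _ "Vr v"]) auto
next
  case (add p q)
  then obtain a b where "pvars a \<subseteq> V" "finite (csts a)" "\<forall>x. ev (\<lambda>v. of_real (x v)) a = of_real (p x)"
    "pvars b \<subseteq> V" "finite (csts b)" "\<forall>x. ev (\<lambda>v. of_real (x v)) b = of_real (q x)" by blast
  then show ?case by (intro exI[of _ "Ad a b"]) auto
next
  case (mult p q)
  then obtain a b where "pvars a \<subseteq> V" "finite (csts a)" "\<forall>x. ev (\<lambda>v. of_real (x v)) a = of_real (p x)"
    "pvars b \<subseteq> V" "finite (csts b)" "\<forall>x. ev (\<lambda>v. of_real (x v)) b = of_real (q x)" by blast
  then show ?case by (intro exI[of _ "Ml a b"]) auto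
qed

section \<open>Algebraic independence, transcendence bases and simple roots\<close>

text \<open>The elements form a family indexed by \<open>W\<close>, so that one notion covers a
  basis and its translates. Being the zero polynomial is expressed by vanishing at all complex
  points, since different expressions can denote the same polynomial.\<close>

definition indep :: "real set \<Rightarrow> 'v set \<Rightarrow> ('v \<Rightarrow> real) \<Rightarrow> bool" where
  "indep F W \<omega> \<longleftrightarrow>
     (\<forall>e\<in>over F W. ev (\<lambda>v. of_real (\<omega> v)) e = 0 \<longrightarrow> (\<forall>u. ev u e = 0))"

text \<open>Elements of \<open>W\<close> are both names of variables and their values. The
  polynomial in \<open>None\<close> has to remain nonzero after these values are inserted.\<close>

definition algebraic_over :: "real set \<Rightarrow> real set \<Rightarrow> real \<Rightarrow> bool" where
  "algebraic_over F W x \<longleftrightarrow> (\<exists>e\<in>over F (insert None (Some ` W)).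
     upoly None (case_option 0 of_real) e \<noteq> 0 \<and> ev (case_option (of_real x) of_real) e = 0)"

lemma algebraic_over_mono: "algebraic_over F W x \<Longrightarrow> W \<subseteq> W' \<Longrightarrow> algebraic_over F W' x"
  unfolding algebraic_over_def by (meson over_mono image_mono insert_mono)

lemma indep_reindex:
  assumes "indep F W \<omega>" "s ` V \<subseteq> W" "inj_on s V"
  shows "indep F V (\<omega> \<circ> s)"
  unfolding indep_def
proof (intro ballI impI allI)
  fix e u assume e: "e \<in> over F V" and z: "ev (\<lambda>v. of_real ((\<omega> \<circ> s) v)) e = 0"
  let ?e = "psubst (\<lambda>v. Vr (s v)) e"
  have "?e \<in> over F W" using e assms(2) by (intro psubst_over) auto
  moreover have "ev (\<lambda>v. of_real (\<omega> v)) ?e = 0" using z by (simp add: ev_psubst)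
  ultimately have "ev (\<lambda>w. u (the_inv_into V s w)) ?e = 0" using assms(1) by (auto simp: indep_def)
  then have "ev (\<lambda>v. u (the_inv_into V s (s v))) e = 0" by (simp add: ev_psubst)
  also have "ev (\<lambda>v. u (the_inv_into V s (s v))) e = ev u e"
    using assms(3) by (intro ev_cong[OF e]) (simp add: the_inv_into_f_f)
  finally show "ev u e = 0" .
qed

text \<open>Substituting \<open>w + \<rho> w\<close> for \<open>w\<close> stays over
  \<open>F\<close> and is undone by evaluating at \<open>u - \<rho>\<close>. This is what permits
  moving elements of a basis into prescribed intervals.\<close>

lemma indep_translate:
  assumes "indep F W \<omega>" "\<And>w. w \<in> W \<Longrightarrow> \<rho> w \<in> F"
  shows "indep F W (\<lambda>w. \<omega> w + \<rho> w)"
  unfolding indep_def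
proof (intro ballI impI allI)
  fix e u assume e: "e \<in> over F W" and z: "ev (\<lambda>w. of_real (\<omega> w + \<rho> w)) e = 0"
  let ?e = "psubst (\<lambda>w. Ad (Vr w) (Cst (\<rho> w))) e"
  have "?e \<in> over F W" using e assms(2) by (intro psubst_over) auto
  moreover have "ev (\<lambda>w. of_real (\<omega> w)) ?e = 0" using z by (simp add: ev_psubst)
  ultimately have "ev (\<lambda>w. u w - of_real (\<rho> w)) ?e = 0" using assms(1) by (auto simp: indep_def)
  then show "ev u e = 0" by (simp add: ev_psubst)
qed

lemma upoly_eq_0_if_Rats:
  assumes "\<And>q. q \<in> \<rat> \<Longrightarrow> ev (u(z := of_real q)) e = 0"
  shows "upoly z u e = 0"
proof -
  have "complex_of_real ` \<rat> \<subseteq> {y. poly (upoly z u e) y = 0}"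
    using assms by (auto simp: poly_upoly)
  moreover have "infinite (complex_of_real ` \<rat>)"
    by (simp add: finite_image_iff inj_on_def Rats_infinite)
  ultimately show ?thesis using poly_roots_finite finite_subset by blast
qed

lemma transcendence_basis_exists:
  assumes F: "\<rat> \<subseteq> F"
  obtains T where "indep F T (\<lambda>x. x)" "\<And>x. \<exists>W. finite W \<and> W \<subseteq> T \<and> algebraic_over F W x"
proof -
  let ?A = "{T. indep F T (\<lambda>x. x)}"
  have "\<exists>M\<in>?A. \<forall>X\<in>?A. M \<subseteq> X \<longrightarrow> X = M"
  proof (rule subset_Zorn)
    fix \<C> assume ch: "subset.chain ?A \<C>"
    have "indep F (\<Union>\<C>) (\<lambda>x. x)"
      unfolding indep_def
    proof (intro ballI impI allI)
      fix e u assume e: "e \<in> over F (\<Union>\<C>)" "ev (\<lambda>v. of_real v) e = 0"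
      show "ev u e = 0"
      proof (cases "\<C> = {}")
        case True
        then have "ev u e = ev (\<lambda>v. of_real v) e" using e by (intro ev_cong[of e F "{}"]) auto
        then show ?thesis using e by simp
      next
        case False
        have "pvars e \<subseteq> \<Union>\<C>" using e by (auto simp: over_def)
        then obtain T where "T \<in> \<C>" "pvars e \<subseteq> T"
          using finite_subset_Union_chain[OF finite_pvars _ False ch] by blast
        then have "e \<in> over F T" "indep F T (\<lambda>x. x)"
          using e ch by (auto simp: over_def subset.chain_def)
        then show ?thesis using e by (auto simp: indep_def)
      qed
    qed
    then show "\<exists>U\<in>?A. \<forall>X\<in>\<C>. X \<subseteq> U" by blast
  qed
  then obtain T where T: "indep F T (\<lambda>x. x)" and mx: "\<And>X. indep F X (\<lambda>x. x) \<Longrightarrow> T \<subseteq> X \<Longrightarrow> X = T"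
    by auto
  have "\<exists>W. finite W \<and> W \<subseteq> T \<and> algebraic_over F W x" for x
  proof (cases "x \<in> T")
    case True
    have "algebraic_over F {x} x"
      unfolding algebraic_over_def
      by (rule bexI[of _ "Ad (Vr None) (Ml (Cst (- 1)) (Vr (Some x)))"]) (use F in auto)
    with True show ?thesis by (intro exI[of _ "{x}"]) auto
  next
    case False
    then have "\<not> indep F (insert x T) (\<lambda>x. x)" using mx by blast
    then obtain e u where e: "e \<in> over F (insert x T)" "ev of_real e = 0" "ev u e \<noteq> 0"
      by (auto simp: indep_def)
    define e' where "e' = psubst (\<lambda>v. Vr (if v = x then None else Some v)) e"
    have ev_e': "ev (case_option y w) e' = ev (w(x := y)) e" for y w
    proof -
      have "(\<lambda>v. case_option y w (if v = x then None else Some v)) = w(x := y)" by auto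
      then show ?thesis by (simp add: e'_def ev_psubst)
    qed
    have opt: "(case_option 0 w)(None := y) = case_option y w" for y :: complex and w :: "real \<Rightarrow> complex"
      by (auto split: option.split)
    \<comment> \<open>Otherwise every rational \<open>q\<close> put for \<open>x\<close> in
      \<open>e\<close> gives a relation among elements of \<open>T\<close>, hence an identity. Then
      \<open>e\<close> vanishes at \<open>u\<close> with \<open>x\<close> replaced by infinitely
      many values, so also at \<open>u\<close> itself.\<close>
    have "upoly None (case_option 0 of_real) e' \<noteq> 0"
    proof
      assume 0: "upoly None (case_option 0 of_real) e' = 0"
      have "ev (u(x := of_real q)) e = 0" if q: "q \<in> \<rat>" for q
      proof -
        let ?e = "psubst (Vr(x := Cst q)) e"
        have sub: "(\<lambda>v. ev w ((Vr(x := Cst q)) v)) = w(x := of_real q)" for w by auto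
        have "poly (upoly None (case_option 0 of_real) e') (of_real q) = 0" using 0 by simp
        then have "ev (of_real(x := of_real q)) e = 0" by (simp add: poly_upoly opt ev_e')
        then have "ev of_real ?e = 0" by (simp only: ev_psubst sub)
        moreover have "?e \<in> over F T" by (rule psubst_over[OF e(1)]) (use q F in auto)
        ultimately have "ev u ?e = 0" using T by (auto simp: indep_def)
        then show ?thesis by (simp only: ev_psubst sub)
      qed
      then have "upoly x u e = 0" by (rule upoly_eq_0_if_Rats)
      then have "poly (upoly x u e) (u x) = 0" by simp
      then show False using e(3) by (simp add: poly_upoly)
    qed
    moreover have "ev (case_option (of_real x) of_real) e' = 0"
      using e(2) by (simp add: ev_e' fun_upd_idem)
    moreover have "e' \<in> over F (insert None (Some ` (pvars e - {x})))"
    proof -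
      have "e \<in> over F (pvars e)" using e by (auto simp: over_def)
      then show ?thesis unfolding e'_def by (rule psubst_over) auto
    qed
    ultimately have "algebraic_over F (pvars e - {x}) x" unfolding algebraic_over_def by blast
    moreover have "pvars e - {x} \<subseteq> T" using e(1) by (auto simp: over_def)
    ultimately show ?thesis by (intro exI[of _ "pvars e - {x}"]) auto
  qed
  with T that show ?thesis by blast
qed

text \<open>The degree drops with each derivative and a nonzero constant has no root, so
  differentiation reaches a stage at which \<open>x\<close> is a root for the last time, and there
  it is simple. This stands in for the minimal polynomial, so \<open>F\<close> need not be a
  field.\<close>

lemma poly_simple_root_pderiv:
  fixes p :: "complex poly"
  assumes "p \<noteq> 0" "poly p x = 0"
  shows "\<exists>k. poly ((pderiv ^^ k) p) x = 0 \<and> poly ((pderiv ^^ Suc k) p) x \<noteq> 0"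
  using assms
proof (induction "degree p" arbitrary: p rule: less_induct)
  case less
  show ?case
  proof (cases "poly (pderiv p) x = 0")
    case False
    then show ?thesis using less by (intro exI[of _ 0]) auto
  next
    case True
    have d: "degree p \<noteq> 0"
    proof
      assume "degree p = 0"
      then obtain c where "p = [:c:]" by (rule degree_eq_zeroE)
      with less.prems show False by simp
    qed
    then have "pderiv p \<noteq> 0" by (simp add: pderiv_eq_0_iff)
    moreover have "degree (pderiv p) < degree p" using d by (simp add: degree_pderiv)
    ultimately obtain k where "poly ((pderiv ^^ k) (pderiv p)) x = 0"
      "poly ((pderiv ^^ Suc k) (pderiv p)) x \<noteq> 0"
      using less.hyps True by blast
    then show ?thesis by (intro exI[of _ "Suc k"]) (simp add: funpow_swap1)
  qed
qed

lemma algebraic_over_simple_root: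
  assumes F: "{0, 1} \<subseteq> F" and alg: "algebraic_over F W x"
  obtains e where "e \<in> over F (insert None (Some ` W))"
    "ev (case_option (of_real x) of_real) e = 0" "ev (case_option (of_real x) of_real) (pdiff None e) \<noteq> 0"
proof -
  let ?u = "case_option 0 of_real :: real option \<Rightarrow> complex"
  have opt: "?u(None := y) = case_option y of_real" for y :: complex
    by (auto split: option.split)
  obtain e where e: "e \<in> over F (insert None (Some ` W))" "upoly None ?u e \<noteq> 0"
      "ev (case_option (of_real x) of_real) e = 0"
    using alg by (auto simp: algebraic_over_def)
  have dk: "(pderiv ^^ k) (upoly None ?u e) = upoly None ?u ((pdiff None ^^ k) e)" for k
    by (induction k) (simp_all add: pderiv_upoly)
  have ok: "(pdiff None ^^ k) e \<in> over F (insert None (Some ` W))" for k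
    by (induction k) (simp_all add: e(1) pdiff_over[OF F])
  have "poly (upoly None ?u e) (of_real x) = 0" using e by (simp add: poly_upoly opt)
  then obtain k where k: "poly ((pderiv ^^ k) (upoly None ?u e)) (of_real x) = 0"
    "poly ((pderiv ^^ Suc k) (upoly None ?u e)) (of_real x) \<noteq> 0"
    using poly_simple_root_pderiv e by blast
  show ?thesis
  proof (rule that[OF ok[of k]])
    show "ev (case_option (of_real x) of_real) ((pdiff None ^^ k) e) = 0"
      using k(1) by (simp only: dk poly_upoly opt)
    show "ev (case_option (of_real x) of_real) (pdiff None ((pdiff None ^^ k) e)) \<noteq> 0"
      using k(2) by (simp only: funpow.simps comp_apply dk pderiv_upoly poly_upoly opt not_False_eq_True)
  qed
qed

section \<open>Functions algebraic over a ring of functions\<close>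

text \<open>Gaussian elimination without division, as \<open>Z\<close> need not contain inverses:
  coordinate \<open>b\<close> is cleared by cross multiplication with a pivot. A coefficient found
  for the smaller system stays nonzero when multiplied by the pivot.\<close>

lemma subring_linear_dependence:
  fixes Z :: "complex set" and v :: "'i \<Rightarrow> 'j \<Rightarrow> complex"
  assumes one: "1 \<in> Z" and add: "\<And>a b. a \<in> Z \<Longrightarrow> b \<in> Z \<Longrightarrow> a + b \<in> Z"
    and mult: "\<And>a b. a \<in> Z \<Longrightarrow> b \<in> Z \<Longrightarrow> a * b \<in> Z" and neg: "\<And>a. a \<in> Z \<Longrightarrow> - a \<in> Z"
    and "finite B" "finite A" "card B < card A" "\<And>i j. i \<in> A \<Longrightarrow> j \<in> B \<Longrightarrow> v i j \<in> Z"
  shows "\<exists>c. (\<forall>i\<in>A. c i \<in> Z) \<and> (\<exists>i\<in>A. c i \<noteq> 0) \<and> (\<forall>j\<in>B. (\<Sum>i\<in>A. c i * v i j) = 0)"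
  using assms(5-)
proof (induction B arbitrary: A v rule: finite_induct)
  case empty
  then obtain i where "i \<in> A" by fastforce
  then show ?case using one by (intro exI[of _ "\<lambda>_. 1"]) auto
next
  case (insert b B)
  have zero: "0 \<in> Z" using add[OF one neg[OF one]] by simp
  have sum: "(\<Sum>i\<in>I. f i) \<in> Z" if "\<And>i. i \<in> I \<Longrightarrow> f i \<in> Z" for I :: "'i set" and f
    using that by (induction I rule: infinite_finite_induct) (auto intro: add zero)
  have card: "card B < card A" "card B < card A - 1" using insert by auto
  show ?case
  proof (cases "\<forall>i\<in>A. v i b = 0")
    case True
    obtain c where "\<forall>i\<in>A. c i \<in> Z" "\<exists>i\<in>A. c i \<noteq> 0" "\<forall>j\<in>B. (\<Sum>i\<in>A. c i * v i j) = 0"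
      using insert.IH[of A v] insert.prems card by blast
    with True show ?thesis by (intro exI[of _ c]) auto
  next
    case False
    then obtain i0 where i0: "i0 \<in> A" "v i0 b \<noteq> 0" by blast
    define A' where "A' = A - {i0}"
    define v' where "v' i j = v i0 b * v i j - v i b * v i0 j" for i j
    have A': "finite A'" "card B < card A'" "A = insert i0 A'" "i0 \<notin> A'"
      using insert.prems card i0 by (auto simp: A'_def)
    have "v' i j \<in> Z" if "i \<in> A'" "j \<in> B" for i j
    proof -
      have "v i0 b * v i j + - (v i b * v i0 j) \<in> Z"
        using that A' insert.prems(3) by (intro add neg mult) auto
      then show ?thesis by (simp add: v'_def)
    qed
    then obtain c' where c': "\<forall>i\<in>A'. c' i \<in> Z" "\<exists>i\<in>A'. c' i \<noteq> 0"
        "\<forall>j\<in>B. (\<Sum>i\<in>A'. c' i * v' i j) = 0"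
      using insert.IH[OF A'(1,2), of v'] by blast
    \<comment> \<open>The coefficient of the pivot vector is forced by coordinate
      \<open>b\<close>.\<close>
    define c where "c i = (if i = i0 then - (\<Sum>i\<in>A'. c' i * v i b) else v i0 b * c' i)" for i
    have split: "(\<Sum>i\<in>A. c i * v i j) = (\<Sum>i\<in>A'. c' i * v' i j)" for j
    proof -
      have "(\<Sum>i\<in>A. c i * v i j) = c i0 * v i0 j + (\<Sum>i\<in>A'. c i * v i j)"
        using A' by simp
      also have "(\<Sum>i\<in>A'. c i * v i j) = (\<Sum>i\<in>A'. v i0 b * c' i * v i j)"
        using A'(4) by (intro sum.cong) (auto simp: c_def)
      also have "c i0 * v i0 j = (\<Sum>i\<in>A'. - (c' i * v i b * v i0 j))"
        by (simp add: c_def sum_distrib_right sum_negf)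
      finally show ?thesis
        by (simp add: v'_def sum.distrib[symmetric] algebra_simps)
    qed
    have "(\<Sum>i\<in>A'. c' i * v' i b) = 0" by (simp add: v'_def)
    then have "\<forall>j\<in>insert b B. (\<Sum>i\<in>A. c i * v i j) = 0" using c' split by auto
    moreover have "\<forall>i\<in>A. c i \<in> Z"
    proof
      fix i assume i: "i \<in> A"
      show "c i \<in> Z"
      proof (cases "i = i0")
        case True
        then show ?thesis using c' insert.prems(3) A' by (auto simp: c_def intro!: neg sum mult)
      next
        case False
        then show ?thesis using c' insert.prems(3) A' i i0 by (auto simp: c_def intro!: mult)
      qed
    qed
    moreover have "\<exists>i\<in>A. c i \<noteq> 0"
      using c'(2) A'(3,4) i0(2) unfolding c_def by (metis insertCI mult_eq_0_iff)
    ultimately show ?thesis by blast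
  qed
qed

text \<open>A ring of functions in which a function vanishing at the generic point \<open>\<omega>\<close> vanishes
  identically; evaluation at \<open>\<omega>\<close> then turns linear algebra over the ring into linear algebra over
  a subring of the complex numbers.\<close>

locale generic_ring =
  fixes S :: "('u \<Rightarrow> complex) set" and \<Omega> :: "'u set" and \<omega> :: 'u
  assumes generic_in: "\<omega> \<in> \<Omega>"
    and one: "(\<lambda>_. 1) \<in> S"
    and add: "f \<in> S \<Longrightarrow> g \<in> S \<Longrightarrow> (\<lambda>u. f u + g u) \<in> S"
    and mult: "f \<in> S \<Longrightarrow> g \<in> S \<Longrightarrow> (\<lambda>u. f u * g u) \<in> S"
    and neg: "f \<in> S \<Longrightarrow> (\<lambda>u. - f u) \<in> S"
    and generic: "f \<in> S \<Longrightarrow> f \<omega> = 0 \<Longrightarrow> u \<in> \<Omega> \<Longrightarrow> f u = 0"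
begin

lemma zero: "(\<lambda>_. 0) \<in> S"
  using add[OF one neg[OF one]] by simp

lemma sum: "(\<And>i. i \<in> I \<Longrightarrow> f i \<in> S) \<Longrightarrow> (\<lambda>u. \<Sum>i\<in>I. f i u) \<in> S"
  by (induction I rule: infinite_finite_induct) (auto intro: add zero)

lemma power: "f \<in> S \<Longrightarrow> (\<lambda>u. f u ^ n) \<in> S"
  by (induction n) (auto intro: one mult)

text \<open>The system is solved at \<open>\<omega>\<close>, its coefficients are lifted to
  functions in the ring, and genericity spreads the equations from \<open>\<omega>\<close> to
  \<open>\<Omega>\<close>.\<close>

lemma linear_dependence:
  assumes "finite B" "finite A" "card B < card A" and v: "\<And>i j. i \<in> A \<Longrightarrow> j \<in> B \<Longrightarrow> v i j \<in> S"
  obtains c where "\<And>i. i \<in> A \<Longrightarrow> c i \<in> S" "\<exists>i\<in>A. c i \<omega> \<noteq> 0"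
    "\<And>j u. j \<in> B \<Longrightarrow> u \<in> \<Omega> \<Longrightarrow> (\<Sum>i\<in>A. c i u * v i j u) = 0"
proof -
  let ?Z = "(\<lambda>f. f \<omega>) ` S"
  have "\<exists>c. (\<forall>i\<in>A. c i \<in> ?Z) \<and> (\<exists>i\<in>A. c i \<noteq> 0) \<and> (\<forall>j\<in>B. (\<Sum>i\<in>A. c i * v i j \<omega>) = 0)"
  proof (rule subring_linear_dependence[OF _ _ _ _ assms(1-3)])
    show "1 \<in> ?Z" using one by (rule rev_image_eqI) simp
  next
    fix a b assume "a \<in> ?Z" "b \<in> ?Z"
    then obtain f g where fg: "f \<in> S" "g \<in> S" "a = f \<omega>" "b = g \<omega>" by blast
    show "a + b \<in> ?Z" using add[OF fg(1,2)] by (rule rev_image_eqI) (simp add: fg)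
    show "a * b \<in> ?Z" using mult[OF fg(1,2)] by (rule rev_image_eqI) (simp add: fg)
  next
    fix a assume "a \<in> ?Z"
    then obtain f where f: "f \<in> S" "a = f \<omega>" by blast
    show "- a \<in> ?Z" using neg[OF f(1)] by (rule rev_image_eqI) (simp add: f)
  qed (use v in blast)
  then obtain c0 where c0: "\<forall>i\<in>A. c0 i \<in> ?Z" "\<exists>i\<in>A. c0 i \<noteq> 0" "\<forall>j\<in>B. (\<Sum>i\<in>A. c0 i * v i j \<omega>) = 0"
    by blast
  have "\<forall>i\<in>A. \<exists>f. f \<in> S \<and> f \<omega> = c0 i" using c0(1) by force
  from bchoice[OF this] obtain c where c: "\<forall>i\<in>A. c i \<in> S \<and> c i \<omega> = c0 i" ..
  show ?thesis
  proof (rule that[of c])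
    fix j u assume ju: "j \<in> B" "u \<in> \<Omega>"
    have "(\<lambda>u. \<Sum>i\<in>A. c i u * v i j u) \<in> S"
      using c v ju(1) by (intro sum mult) auto
    moreover have "(\<Sum>i\<in>A. c i \<omega> * v i j \<omega>) = (\<Sum>i\<in>A. c0 i * v i j \<omega>)"
      using c by (intro sum.cong) auto
    ultimately show "(\<Sum>i\<in>A. c i u * v i j u) = 0"
      using generic[OF _ _ ju(2)] c0(3) ju(1) by auto
  qed (use c c0(2) in auto)
qed

text \<open>A value at \<open>\<omega>\<close> different from zero plays the part of a nonzero
  coefficient: a ring function that is zero there is zero on all of \<open>\<Omega>\<close>.\<close>

definition alg_fun :: "('u \<Rightarrow> complex) \<Rightarrow> bool" where
  "alg_fun \<phi> \<longleftrightarrow> (\<exists>D c. (\<forall>m\<le>D. c m \<in> S) \<and> (\<exists>m\<le>D. c m \<omega> \<noteq> 0) \<and>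
     (\<forall>u\<in>\<Omega>. (\<Sum>m\<le>D. c m u * \<phi> u ^ m) = 0))"

lemma alg_fun_ring: "f \<in> S \<Longrightarrow> alg_fun f"
  unfolding alg_fun_def
  by (rule exI[of _ 1], rule exI[of _ "\<lambda>m. if m = 0 then f else (\<lambda>_. - 1)"])
    (auto intro: neg one intro!: exI[of _ 1])

lemma alg_fun_top:
  assumes "alg_fun \<phi>"
  obtains D a where "D > 0" "\<And>m. m \<le> D \<Longrightarrow> a m \<in> S" "a D \<omega> \<noteq> 0"
    "\<And>u. u \<in> \<Omega> \<Longrightarrow> (\<Sum>m\<le>D. a m u * \<phi> u ^ m) = 0"
proof -
  obtain N c where c: "\<forall>m\<le>N. c m \<in> S" "\<exists>m\<le>N. c m \<omega> \<noteq> 0"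
      "\<forall>u\<in>\<Omega>. (\<Sum>m\<le>N. c m u * \<phi> u ^ m) = 0"
    using assms by (auto simp: alg_fun_def)
  define D where "D = Max {m. m \<le> N \<and> c m \<omega> \<noteq> 0}"
  have "D \<in> {m. m \<le> N \<and> c m \<omega> \<noteq> 0}"
    unfolding D_def by (rule Max_in) (use c(2) in auto)
  then have D: "D \<le> N" "c D \<omega> \<noteq> 0" by auto
  have above: "c m \<omega> = 0" if "D < m" "m \<le> N" for m
  proof (rule ccontr)
    assume "c m \<omega> \<noteq> 0"
    then have "m \<le> D" unfolding D_def using that by (intro Max_ge) auto
    with that show False by simp
  qed
  have rel: "(\<Sum>m\<le>D. c m u * \<phi> u ^ m) = 0" if u: "u \<in> \<Omega>" for u
  proof -
    have "(\<Sum>m\<le>N. c m u * \<phi> u ^ m) = (\<Sum>m\<le>D. c m u * \<phi> u ^ m)"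
      using D above c(1) generic[OF _ _ u] by (intro sum.mono_neutral_right) auto
    with c(3) u show ?thesis by simp
  qed
  moreover have "D > 0"
  proof (rule ccontr)
    assume "\<not> D > 0"
    then have "D = 0" by simp
    with rel[OF generic_in] D(2) show False by simp
  qed
  ultimately show ?thesis using that[of D c] c(1) D by auto
qed

text \<open>The finite-module argument for sums and products of algebraic elements, without
  fractions. The relations are not monic, so multiplication by \<open>\<phi>\<close> may leave the
  span of the monomials \<open>\<phi> ^ i * \<psi> ^ j\<close> with \<open>i < D\<close> and
  \<open>j < E\<close>, but multiplication by \<open>a D * \<phi>\<close> and by
  \<open>b E * \<psi>\<close> preserves it. Hence so does multiplication by \<open>a D * b E\<close>
  times the sum or the product.\<close>

lemma alg_fun_add_mult:
  assumes "alg_fun \<phi>" "alg_fun \<psi>"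
  shows "alg_fun (\<lambda>u. \<phi> u + \<psi> u)" "alg_fun (\<lambda>u. \<phi> u * \<psi> u)"
proof -
  obtain D a where a: "D > 0" "\<And>m. m \<le> D \<Longrightarrow> a m \<in> S" "a D \<omega> \<noteq> 0"
    "\<And>u. u \<in> \<Omega> \<Longrightarrow> (\<Sum>m\<le>D. a m u * \<phi> u ^ m) = 0" using alg_fun_top[OF assms(1)] by blast
  obtain E b where b: "E > 0" "\<And>m. m \<le> E \<Longrightarrow> b m \<in> S" "b E \<omega> \<noteq> 0"
    "\<And>u. u \<in> \<Omega> \<Longrightarrow> (\<Sum>m\<le>E. b m u * \<psi> u ^ m) = 0" using alg_fun_top[OF assms(2)] by blast
  define B where "B = {..<D} \<times> {..<E}"
  define sp where "sp \<chi>' \<longleftrightarrow> (\<exists>s. (\<forall>p\<in>B. s p \<in> S) \<and>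
     (\<forall>u\<in>\<Omega>. \<chi>' u = (\<Sum>p\<in>B. s p u * (\<phi> u ^ fst p * \<psi> u ^ snd p))))" for \<chi>'
  have finB: "finite B" by (simp add: B_def)
  have sp_cong: "sp f \<longleftrightarrow> sp g" if "\<And>u. u \<in> \<Omega> \<Longrightarrow> f u = g u" for f g
    using that unfolding sp_def by simp
  have sp_zero: "sp (\<lambda>_. 0)"
    unfolding sp_def by (rule exI[of _ "\<lambda>_ _. 0"]) (auto intro: zero)
  have sp_add: "sp (\<lambda>u. f u + g u)" if "sp f" "sp g" for f g
  proof -
    from that(1) obtain s where "\<forall>p\<in>B. s p \<in> S"
      "\<forall>u\<in>\<Omega>. f u = (\<Sum>p\<in>B. s p u * (\<phi> u ^ fst p * \<psi> u ^ snd p))"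
      unfolding sp_def by blast
    moreover from that(2) obtain t where "\<forall>p\<in>B. t p \<in> S"
      "\<forall>u\<in>\<Omega>. g u = (\<Sum>p\<in>B. t p u * (\<phi> u ^ fst p * \<psi> u ^ snd p))"
      unfolding sp_def by blast
    ultimately show ?thesis
      unfolding sp_def by (intro exI[of _ "\<lambda>p u. s p u + t p u"])
        (auto intro: add simp: sum.distrib distrib_right)
  qed
  have sp_scale: "sp (\<lambda>u. h u * f u)" if "sp f" "h \<in> S" for f h
  proof -
    from that(1) obtain s where "\<forall>p\<in>B. s p \<in> S"
      "\<forall>u\<in>\<Omega>. f u = (\<Sum>p\<in>B. s p u * (\<phi> u ^ fst p * \<psi> u ^ snd p))"
      unfolding sp_def by blast
    then show ?thesis
      unfolding sp_def using that(2) by (intro exI[of _ "\<lambda>p u. h u * s p u"])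
        (auto intro: mult simp: sum_distrib_left mult.assoc)
  qed
  have sp_sum: "sp (\<lambda>u. \<Sum>i\<in>I. f i u)" if "finite I" "\<And>i. i \<in> I \<Longrightarrow> sp (f i)" for I :: "'k set" and f
    using that by (induction I rule: finite_induct) (auto intro: sp_zero sp_add)
  have sp_basis: "sp (\<lambda>u. \<phi> u ^ i * \<psi> u ^ j)" if "i < D" "j < E" for i j
    unfolding sp_def
  proof (intro exI[of _ "\<lambda>p u. if p = (i, j) then 1 else 0"] conjI ballI)
    fix u
    have "(\<Sum>p\<in>B. (if p = (i, j) then 1 else 0) * (\<phi> u ^ fst p * \<psi> u ^ snd p)) =
        (\<Sum>p\<in>B. if p = (i, j) then \<phi> u ^ i * \<psi> u ^ j else 0)"
      by (intro sum.cong) auto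
    also have "\<dots> = \<phi> u ^ i * \<psi> u ^ j" using that finB by (simp add: B_def)
    finally show "\<phi> u ^ i * \<psi> u ^ j = (\<Sum>p\<in>B. (if p = (i, j) then 1 else 0) * (\<phi> u ^ fst p * \<psi> u ^ snd p))" ..
  next
    fix p show "(\<lambda>u. if p = (i, j) then 1 else 0) \<in> S"
      by (cases "p = (i, j)") (auto intro: one zero)
  qed
  have step1: "sp (\<lambda>u. a D u * \<phi> u * (\<phi> u ^ i * \<psi> u ^ j))" if ij: "i < D" "j < E" for i j
  proof (cases "Suc i < D")
    case True
    have "sp (\<lambda>u. a D u * (\<phi> u ^ Suc i * \<psi> u ^ j))" by (intro sp_scale sp_basis True ij a) simp
    then show ?thesis by (simp add: ac_simps)
  next
    case False
    then have D: "D = Suc i" using ij by simp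
    have "sp (\<lambda>u. \<Sum>m<D. - a m u * (\<phi> u ^ m * \<psi> u ^ j))"
      by (intro sp_sum sp_scale sp_basis neg a ij) auto
    moreover have "(\<Sum>m<D. - a m u * (\<phi> u ^ m * \<psi> u ^ j)) = a D u * \<phi> u * (\<phi> u ^ i * \<psi> u ^ j)"
      if "u \<in> \<Omega>" for u
    proof -
      have "a D u * \<phi> u ^ D = - (\<Sum>m<D. a m u * \<phi> u ^ m)"
        using a(4)[OF that] by (simp add: lessThan_Suc_atMost[symmetric] eq_neg_iff_add_eq_0 add.commute)
      moreover have "(\<Sum>m<D. - a m u * (\<phi> u ^ m * \<psi> u ^ j)) = - (\<Sum>m<D. a m u * \<phi> u ^ m) * \<psi> u ^ j"
        by (simp add: sum_distrib_right sum_negf mult.assoc)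
      moreover have "\<phi> u ^ D = \<phi> u * \<phi> u ^ i" using D by simp
      ultimately show ?thesis by (metis (no_types, lifting) mult.assoc)
    qed
    ultimately show ?thesis using sp_cong by (metis (no_types, lifting))
  qed
  have step2: "sp (\<lambda>u. b E u * \<psi> u * (\<phi> u ^ i * \<psi> u ^ j))" if ij: "i < D" "j < E" for i j
  proof (cases "Suc j < E")
    case True
    have "sp (\<lambda>u. b E u * (\<phi> u ^ i * \<psi> u ^ Suc j))" by (intro sp_scale sp_basis True ij b) simp
    then show ?thesis by (simp add: ac_simps)
  next
    case False
    then have E: "E = Suc j" using ij by simp
    have "sp (\<lambda>u. \<Sum>m<E. - b m u * (\<phi> u ^ i * \<psi> u ^ m))"
      by (intro sp_sum sp_scale sp_basis neg b ij) auto
    moreover have "(\<Sum>m<E. - b m u * (\<phi> u ^ i * \<psi> u ^ m)) = b E u * \<psi> u * (\<phi> u ^ i * \<psi> u ^ j)"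
      if "u \<in> \<Omega>" for u
    proof -
      have "b E u * \<psi> u ^ E = - (\<Sum>m<E. b m u * \<psi> u ^ m)"
        using b(4)[OF that] by (simp add: lessThan_Suc_atMost[symmetric] eq_neg_iff_add_eq_0 add.commute)
      moreover have "(\<Sum>m<E. - b m u * (\<phi> u ^ i * \<psi> u ^ m)) = - (\<Sum>m<E. b m u * \<psi> u ^ m) * \<phi> u ^ i"
        by (simp add: sum_distrib_left sum_negf ac_simps)
      moreover have "\<psi> u ^ E = \<psi> u * \<psi> u ^ j" using E by simp
      ultimately show ?thesis by (metis (no_types, lifting) mult.assoc mult.commute)
    qed
    ultimately show ?thesis using sp_cong by (metis (no_types, lifting))
  qed
  have lift: "sp (\<lambda>u. h u * f u)"
    if f: "sp f" and h: "\<And>i j. i < D \<Longrightarrow> j < E \<Longrightarrow> sp (\<lambda>u. h u * (\<phi> u ^ i * \<psi> u ^ j))" for f h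
  proof -
    from f obtain s where s: "\<forall>p\<in>B. s p \<in> S"
      "\<forall>u\<in>\<Omega>. f u = (\<Sum>p\<in>B. s p u * (\<phi> u ^ fst p * \<psi> u ^ snd p))"
      unfolding sp_def by blast
    have "sp (\<lambda>u. \<Sum>p\<in>B. s p u * (h u * (\<phi> u ^ fst p * \<psi> u ^ snd p)))"
      using s(1) by (intro sp_sum finB sp_scale h) (auto simp: B_def)
    moreover have "(\<Sum>p\<in>B. s p u * (h u * (\<phi> u ^ fst p * \<psi> u ^ snd p))) = h u * f u"
      if "u \<in> \<Omega>" for u
      using s(2) that by (simp add: sum_distrib_left ac_simps)
    ultimately show ?thesis using sp_cong by (metis (no_types, lifting))
  qed
  have fin: "alg_fun \<tau>" if \<tau>: "\<And>f. sp f \<Longrightarrow> sp (\<lambda>u. a D u * b E u * \<tau> u * f u)" for \<tau>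
  proof -
    let ?l = "\<lambda>u. a D u * b E u"
    have lS: "?l \<in> S" using a b by (intro mult) auto
    have "sp (\<lambda>u. ?l u ^ N * \<tau> u ^ N)" for N
    proof (induction N)
      case 0
      show ?case using sp_basis[of 0 0] a(1) b(1) by simp
    next
      case (Suc N)
      from \<tau>[OF this] show ?case by (simp add: ac_simps)
    qed
    then have "\<forall>N. \<exists>s. (\<forall>p\<in>B. s p \<in> S) \<and>
        (\<forall>u\<in>\<Omega>. ?l u ^ N * \<tau> u ^ N = (\<Sum>p\<in>B. s p u * (\<phi> u ^ fst p * \<psi> u ^ snd p)))"
      unfolding sp_def by blast
    from choice[OF this] obtain s where s: "\<And>N p. p \<in> B \<Longrightarrow> s N p \<in> S"
      "\<And>N u. u \<in> \<Omega> \<Longrightarrow> ?l u ^ N * \<tau> u ^ N = (\<Sum>p\<in>B. s N p u * (\<phi> u ^ fst p * \<psi> u ^ snd p))"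
      by blast
    \<comment> \<open>One more power than there are generators. In the resulting relation for
      \<open>\<tau>\<close> the coefficients are \<open>c i u * ?l u ^ i\<close>, not all zero at
      \<open>\<omega>\<close> because \<open>a D\<close> and \<open>b E\<close> are nonzero
      there.\<close>
    obtain c where c: "\<And>i. i \<in> {..card B} \<Longrightarrow> c i \<in> S" "\<exists>i\<in>{..card B}. c i \<omega> \<noteq> 0"
      "\<And>p u. p \<in> B \<Longrightarrow> u \<in> \<Omega> \<Longrightarrow> (\<Sum>i\<le>card B. c i u * s i p u) = 0"
      using linear_dependence[OF finB, of "{..card B}" s] s(1) by auto
    have "(\<Sum>i\<le>card B. (c i u * ?l u ^ i) * \<tau> u ^ i) = 0" if u: "u \<in> \<Omega>" for u
    proof -
      have "(\<Sum>i\<le>card B. (c i u * ?l u ^ i) * \<tau> u ^ i) =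
          (\<Sum>i\<le>card B. \<Sum>p\<in>B. c i u * s i p u * (\<phi> u ^ fst p * \<psi> u ^ snd p))"
        using s(2)[OF u] by (simp add: mult.assoc sum_distrib_left)
      also have "\<dots> = (\<Sum>p\<in>B. \<Sum>i\<le>card B. c i u * s i p u * (\<phi> u ^ fst p * \<psi> u ^ snd p))"
        by (rule sum.swap)
      also have "\<dots> = (\<Sum>p\<in>B. (\<Sum>i\<le>card B. c i u * s i p u) * (\<phi> u ^ fst p * \<psi> u ^ snd p))"
        by (simp add: sum_distrib_right)
      also have "\<dots> = 0" using c(3)[OF _ u] by simp
      finally show ?thesis .
    qed
    then show ?thesis
      unfolding alg_fun_def using c(1,2) a(3) b(3) lS
      by (intro exI[of _ "card B"] exI[of _ "\<lambda>i u. c i u * ?l u ^ i"]) (auto intro!: mult power)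
  qed
  have f1: "sp (\<lambda>u. a D u * \<phi> u * f u)" "sp (\<lambda>u. b E u * \<psi> u * f u)" if "sp f" for f
    using lift[OF that step1] lift[OF that step2] by auto
  have aS: "a D \<in> S" "b E \<in> S" using a b by auto
  show "alg_fun (\<lambda>u. \<phi> u + \<psi> u)"
  proof (rule fin)
    fix f assume f: "sp f"
    have "sp (\<lambda>u. b E u * (a D u * \<phi> u * f u) + a D u * (b E u * \<psi> u * f u))"
      by (intro sp_add sp_scale f1 f aS)
    then show "sp (\<lambda>u. a D u * b E u * (\<phi> u + \<psi> u) * f u)" by (simp add: algebra_simps)
  qed
  show "alg_fun (\<lambda>u. \<phi> u * \<psi> u)"
  proof (rule fin)
    fix f assume f: "sp f"
    have "sp (\<lambda>u. a D u * \<phi> u * (b E u * \<psi> u * f u))" by (intro f1 f)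
    then show "sp (\<lambda>u. a D u * b E u * (\<phi> u * \<psi> u) * f u)" by (simp add: ac_simps)
  qed
qed

end

section \<open>Simple roots as holomorphic functions\<close>

lemma ev_tendsto:
  assumes "e \<in> over F V" "\<And>v. v \<in> V \<Longrightarrow> ((\<lambda>n. w n v) \<longlongrightarrow> w0 v) G"
  shows "((\<lambda>n. ev (w n) e) \<longlongrightarrow> ev w0 e) G"
  using assms(1) by (induction e) (auto intro!: tendsto_intros assms(2))

lemma ev_continuous_uniformly:
  assumes e: "e \<in> over F V" and \<eta>: "0 < \<eta>"
  obtains \<epsilon> where "\<epsilon> > 0" "\<And>w. (\<And>v. v \<in> V \<Longrightarrow> cmod (w v - w0 v) < \<epsilon>) \<Longrightarrow> cmod (ev w e - ev w0 e) < \<eta>"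
proof (rule ccontr)
  assume "\<not> thesis"
  with that have "\<forall>n. \<exists>w. (\<forall>v\<in>V. cmod (w v - w0 v) < 1 / real (Suc n)) \<and> \<not> cmod (ev w e - ev w0 e) < \<eta>"
    by (metis of_nat_0_less_iff zero_less_Suc zero_less_divide_1_iff)
  from choice[OF this] obtain w where
    w: "\<And>n v. v \<in> V \<Longrightarrow> cmod (w n v - w0 v) < 1 / real (Suc n)" "\<And>n. \<not> cmod (ev (w n) e - ev w0 e) < \<eta>"
    by blast
  have "(\<lambda>n. ev (w n) e) \<longlonglongrightarrow> ev w0 e"
  proof (rule ev_tendsto[OF e])
    fix v assume v: "v \<in> V"
    have "(\<lambda>n. w n v - w0 v) \<longlonglongrightarrow> 0"
      by (rule Lim_null_comparison[OF _ LIMSEQ_inverse_real_of_nat])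
        (use less_imp_le[OF w(1)[OF v]] in \<open>simp add: inverse_eq_divide\<close>)
    then show "(\<lambda>n. w n v) \<longlonglongrightarrow> w0 v" by (simp add: LIM_zero_iff)
  qed
  then have "\<forall>\<^sub>F n in sequentially. dist (ev (w n) e) (ev w0 e) < \<eta>"
    using \<eta> by (rule tendstoD)
  then have "\<forall>\<^sub>F n in sequentially. False"
    by eventually_elim (use w(2) in \<open>simp add: dist_norm\<close>)
  then show False by simp
qed

text \<open>In the expressions below \<open>None\<close> is the dependent variable and \<open>Some l\<close> the \<open>l\<close>-th
  parameter.\<close>

definition in_box :: "nat \<Rightarrow> real list \<Rightarrow> real \<Rightarrow> (nat \<Rightarrow> complex) \<Rightarrow> bool" where
  "in_box d q r u \<longleftrightarrow> (\<forall>l<d. cmod (u l - of_real (q ! l)) < r)"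

text \<open>The lower Lipschitz bound, with \<open>\<delta>\<close> uniform in the parameters,
  yields uniqueness of the root at once and its continuity later; the nonzero derivative then yields
  differentiability.\<close>

definition simple_root_on ::
  "((nat \<Rightarrow> complex) \<Rightarrow> bool) \<Rightarrow> nat option pexpr \<Rightarrow> real \<Rightarrow> real \<Rightarrow> bool" where
  "simple_root_on P Q c s \<longleftrightarrow> (\<exists>\<delta>>0. \<forall>u. P u \<longrightarrow>
     (\<exists>y\<in>ball (of_real c) s. ev (case_option y u) Q = 0) \<and>
     (\<forall>y\<in>ball (of_real c) s. \<forall>y'\<in>ball (of_real c) s.
        \<delta> * cmod (y - y') \<le> cmod (ev (case_option y u) Q - ev (case_option y' u) Q)) \<and>
     (\<forall>y\<in>ball (of_real c) s. ev (case_option y u) (pdiff None Q) \<noteq> 0))"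

definition rt :: "nat option pexpr \<Rightarrow> real \<Rightarrow> real \<Rightarrow> (nat \<Rightarrow> complex) \<Rightarrow> complex" where
  "rt Q c s u = (THE y. y \<in> ball (of_real c) s \<and> ev (case_option y u) Q = 0)"

lemma simple_root_on_mono:
  "simple_root_on P Q c s \<Longrightarrow> (\<And>u. P' u \<Longrightarrow> P u) \<Longrightarrow> simple_root_on P' Q c s"
  unfolding simple_root_on_def by blast

lemma rt_unique:
  assumes "simple_root_on P Q c s" "P u" "y \<in> ball (of_real c) s" "ev (case_option y u) Q = 0"
  shows "rt Q c s u = y"
  unfolding rt_def
proof (rule the_equality)
  obtain \<delta> where \<delta>: "\<delta> > 0" "\<And>y y'. y \<in> ball (of_real c) s \<Longrightarrow> y' \<in> ball (of_real c) s \<Longrightarrow>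
      \<delta> * cmod (y - y') \<le> cmod (ev (case_option y u) Q - ev (case_option y' u) Q)"
    using assms(1,2) unfolding simple_root_on_def by blast
  fix y' assume y': "y' \<in> ball (of_real c) s \<and> ev (case_option y' u) Q = 0"
  then have "\<delta> * cmod (y' - y) \<le> 0" using \<delta>(2)[of y' y] assms by simp
  then show "y' = y" using \<delta>(1) by (simp add: mult_le_0_iff)
qed (use assms in simp)

lemma rt_root:
  assumes "simple_root_on P Q c s" "P u"
  shows "rt Q c s u \<in> ball (of_real c) s" "ev (case_option (rt Q c s u) u) Q = 0"
    "ev (case_option (rt Q c s u) u) (pdiff None Q) \<noteq> 0"
proof -
  obtain y where y: "y \<in> ball (of_real c) s" "ev (case_option y u) Q = 0"
    using assms unfolding simple_root_on_def by blast
  moreover have "ev (case_option y u) (pdiff None Q) \<noteq> 0"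
    using y assms unfolding simple_root_on_def by blast
  moreover have "rt Q c s u = y" by (rule rt_unique[OF assms y])
  ultimately show "rt Q c s u \<in> ball (of_real c) s" "ev (case_option (rt Q c s u) u) Q = 0"
    "ev (case_option (rt Q c s u) u) (pdiff None Q) \<noteq> 0" by auto
qed

lemma ev_option_cong:
  assumes "Q \<in> over F (insert None (Some ` V))" "\<And>l. l \<in> V \<Longrightarrow> u l = u' l"
  shows "ev (case_option y u) Q = ev (case_option y u') Q"
  by (rule ev_cong[OF assms(1)]) (use assms(2) in auto)

lemma rt_cong:
  assumes "Q \<in> over F (insert None (Some ` {..<d}))" "\<And>l. l < d \<Longrightarrow> u l = u' l"
  shows "rt Q c s u = rt Q c s u'"
proof -
  have "ev (case_option y u) Q = ev (case_option y u') Q" for y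
    by (rule ev_option_cong[OF assms(1)]) (use assms(2) in auto)
  then show ?thesis by (simp add: rt_def)
qed

text \<open>The constants of \<open>Q\<close>, the centre and the parameters are real, so the
  conjugate of the root is again a root in the disc; uniqueness makes the two equal.\<close>

lemma rt_real:
  assumes "simple_root_on P Q c s" "P (\<lambda>l. of_real (x l))"
  shows "rt Q c s (\<lambda>l. of_real (x l)) = of_real (Re (rt Q c s (\<lambda>l. of_real (x l))))"
proof -
  let ?u = "\<lambda>l. complex_of_real (x l)"
  let ?y = "rt Q c s ?u"
  have "ev (case_option (cnj ?y) ?u) Q = ev (\<lambda>v. cnj (case_option ?y ?u v)) Q"
    by (rule arg_cong[of _ _ "\<lambda>u. ev u Q"]) (auto split: option.split)
  also have "\<dots> = 0" using rt_root(2)[OF assms] by (simp add: ev_cnj)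
  finally have "ev (case_option (cnj ?y) ?u) Q = 0" .
  moreover have "cnj ?y \<in> ball (of_real c) s"
  proof -
    have "dist (of_real c) (cnj ?y) = cmod (cnj (of_real c - ?y))" by (simp add: dist_norm)
    also have "\<dots> = dist (of_real c) ?y" by (simp only: complex_mod_cnj dist_norm)
    finally show ?thesis using rt_root(1)[OF assms] by simp
  qed
  ultimately have "?y = cnj ?y" by (intro rt_unique[OF assms])
  then have "Im ?y = - Im ?y" by (metis cnj.simps(2))
  then show ?thesis by (intro complex_eqI) auto
qed

text \<open>Near the given point the derivative of \<open>Q\<close> in \<open>None\<close> stays
  within half of \<open>cmod a\<close> of its value \<open>a\<close>. So \<open>Q\<close> minus
  \<open>a * y\<close> is Lipschitz with constant \<open>cmod a / 2\<close>, and \<open>Q\<close>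
  stretches distances by at least this factor. For nearby parameters \<open>cmod\<close> of
  \<open>Q\<close> is larger on a small circle than at its centre, so there is a zero
  inside.\<close>

lemma simple_root_local:
  assumes Q: "Q \<in> over F (insert None (Some ` V))" and F: "{0, 1} \<subseteq> F"
    and root: "ev (case_option (of_real x) t) Q = 0"
    and simple: "ev (case_option (of_real x) t) (pdiff None Q) \<noteq> 0"
  obtains c s \<epsilon> where "c \<in> \<rat>" "s \<in> \<rat>" "\<epsilon> > 0" "of_real x \<in> ball (complex_of_real c) s"
    "simple_root_on (\<lambda>u. \<forall>l\<in>V. cmod (u l - t l) < \<epsilon>) Q c s"
proof -
  define a where "a = ev (case_option (of_real x) t) (pdiff None Q)"
  have a: "cmod a / 2 > 0" using simple by (simp add: a_def)
  have Q': "pdiff None Q \<in> over F (insert None (Some ` V))" by (rule pdiff_over[OF F Q])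
  obtain \<epsilon>1 where \<epsilon>1: "\<epsilon>1 > 0" "\<And>w. (\<And>v. v \<in> insert None (Some ` V) \<Longrightarrow>
        cmod (w v - case_option (of_real x) t v) < \<epsilon>1) \<Longrightarrow>
      cmod (ev w (pdiff None Q) - ev (case_option (of_real x) t) (pdiff None Q)) < cmod a / 2"
    using ev_continuous_uniformly[OF Q' a] by blast
  have near: "cmod (ev (case_option y u) (pdiff None Q) - a) < cmod a / 2"
    if "cmod (y - of_real x) < \<epsilon>1" "\<forall>l\<in>V. cmod (u l - t l) < \<epsilon>1" for y u
    unfolding a_def by (rule \<epsilon>1(2)[unfolded a_def]) (use that in auto)
  \<comment> \<open>The distance from \<open>x\<close> to \<open>c\<close> is below
    \<open>\<epsilon>1 / 4 < s\<close>, and \<open>s + \<epsilon>1 / 4 < \<epsilon>1\<close>: the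
    disc contains \<open>x\<close> and stays within \<open>\<epsilon>1\<close> of it.\<close>
  obtain c where c: "c \<in> \<rat>" "x < c" "c < x + \<epsilon>1 / 4"
    using Rats_dense_in_real[of x "x + \<epsilon>1 / 4"] \<epsilon>1 by auto
  obtain s where s: "s \<in> \<rat>" "\<epsilon>1 / 4 < s" "s < \<epsilon>1 / 2"
    using Rats_dense_in_real[of "\<epsilon>1 / 4" "\<epsilon>1 / 2"] \<epsilon>1 by auto
  let ?B = "ball (complex_of_real c) s"
  have xB: "of_real x \<in> ?B"
    using c s by (simp add: dist_norm flip: of_real_diff)
  have B\<epsilon>: "cmod (y - of_real x) < \<epsilon>1" if "y \<in> ?B" for y
  proof -
    have "cmod (y - of_real x) \<le> cmod (y - of_real c) + cmod (of_real c - of_real x)"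
      using norm_triangle_ineq[of "y - of_real c" "of_real c - of_real x"] by simp
    also have "cmod (of_real c - of_real x) = c - x"
      using c by (simp flip: of_real_diff)
    finally show ?thesis using that c s by (simp add: dist_norm norm_minus_commute)
  qed
  have lip: "cmod a / 2 * cmod (y - y') \<le> cmod (ev (case_option y u) Q - ev (case_option y' u) Q)"
    if u: "\<forall>l\<in>V. cmod (u l - t l) < \<epsilon>1" and y: "y \<in> ?B" "y' \<in> ?B" for u y y'
  proof -
    define h where "h z = ev (case_option z u) Q - a * z" for z
    have "(case_option 0 u)(None := z) = case_option z u" for z :: complex
      by (auto split: option.split)
    then have der: "((\<lambda>z. ev (case_option z u) Q) has_field_derivative ev (case_option z u) (pdiff None Q)) (at z within ?B)" for z
      using has_field_derivative_ev[of "case_option 0 u" None Q z ?B] by simp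
    have "(h has_field_derivative (ev (case_option z u) (pdiff None Q) - a)) (at z within ?B)" for z
      unfolding h_def by (auto intro!: derivative_eq_intros der)
    moreover have "cmod (ev (case_option z u) (pdiff None Q) - a) \<le> cmod a / 2" if "z \<in> ?B" for z
      using near[OF B\<epsilon>[OF that] u] by simp
    ultimately have "cmod (h y - h y') \<le> cmod a / 2 * cmod (y - y')"
      by (intro field_differentiable_bound[of ?B h _ "cmod a / 2"]) (use y in auto)
    moreover have "cmod (a * (y - y')) - cmod (h y - h y')
        \<le> cmod (ev (case_option y u) Q - ev (case_option y' u) Q)"
    proof -
      have "ev (case_option y u) Q - ev (case_option y' u) Q = a * (y - y') + (h y - h y')"
        by (simp add: h_def algebra_simps)
      then show ?thesis by (metis norm_diff_ineq)
    qed
    ultimately show ?thesis by (simp add: norm_mult)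
  qed
  have "open ?B" by simp
  then obtain \<rho>0 where \<rho>0: "\<rho>0 > 0" "cball (complex_of_real x) \<rho>0 \<subseteq> ?B"
    using xB open_contains_cball by blast
  \<comment> \<open>On the circle the value differs from the central one by at least
    \<open>cmod a / 2 * \<rho>0\<close>. A central value below half of that leaves the larger
    modulus to the circle.\<close>
  have \<eta>: "cmod a / 2 * \<rho>0 / 2 > 0" using a \<rho>0 by simp
  obtain \<epsilon>2 where \<epsilon>2: "\<epsilon>2 > 0" "\<And>w. (\<And>v. v \<in> insert None (Some ` V) \<Longrightarrow>
        cmod (w v - case_option (of_real x) t v) < \<epsilon>2) \<Longrightarrow>
      cmod (ev w Q - ev (case_option (of_real x) t) Q) < cmod a / 2 * \<rho>0 / 2"
    using ev_continuous_uniformly[OF Q \<eta>] by blast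
  define \<epsilon> where "\<epsilon> = min \<epsilon>1 \<epsilon>2"
  have \<epsilon>: "\<epsilon> > 0" "\<epsilon> \<le> \<epsilon>1" "\<epsilon> \<le> \<epsilon>2" using \<epsilon>1 \<epsilon>2 by (auto simp: \<epsilon>_def)
  have exist: "\<exists>y\<in>?B. ev (case_option y u) Q = 0" if u: "\<forall>l\<in>V. cmod (u l - t l) < \<epsilon>" for u
  proof -
    let ?f = "\<lambda>y. ev (case_option y u) Q"
    have u1: "\<forall>l\<in>V. cmod (u l - t l) < \<epsilon>1" using u \<epsilon> by fastforce
    have x0: "cmod (?f (of_real x)) < cmod a / 2 * \<rho>0 / 2"
    proof -
      have "cmod (ev (case_option (of_real x) u) Q - ev (case_option (of_real x) t) Q) < cmod a / 2 * \<rho>0 / 2"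
      proof (rule \<epsilon>2(2))
        fix v assume "v \<in> insert None (Some ` V)"
        then show "cmod (case_option (of_real x) u v - case_option (of_real x) t v) < \<epsilon>2"
          using \<epsilon>2(1) \<epsilon>(3) u by fastforce
      qed
      then show ?thesis using root by simp
    qed
    have opt: "(case_option 0 u)(None := z) = case_option z u" for z :: complex
      by (auto split: option.split)
    have f_poly: "?f = poly (upoly None (case_option 0 u) Q)"
      by (rule ext) (simp add: poly_upoly opt)
    show ?thesis
    proof (rule holomorphic_contract_to_zero[of "complex_of_real x" \<rho>0 ?f])
      show "continuous_on (cball (complex_of_real x) \<rho>0) ?f"
        unfolding f_poly by (intro continuous_intros)
      show "?f holomorphic_on ball (complex_of_real x) \<rho>0"
        unfolding f_poly by (intro holomorphic_intros)
      fix z assume z: "cmod (complex_of_real x - z) = \<rho>0"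
      have zB: "z \<in> ?B" using \<rho>0(2) z by (auto simp: dist_norm)
      have "cmod a / 2 * \<rho>0 \<le> cmod (?f z - ?f (of_real x))"
        using lip[OF u1 zB xB] z by (simp add: norm_minus_commute)
      also have "\<dots> \<le> cmod (?f z) + cmod (?f (of_real x))" by (rule norm_triangle_ineq4)
      finally show "cmod (?f (of_real x)) < cmod (?f z)" using x0 by linarith
    next
      fix z assume "z \<in> ball (complex_of_real x) \<rho>0" "?f z = 0"
      then show ?thesis using \<rho>0(2) by force
    qed (rule \<rho>0)
  qed
  have nz: "ev (case_option y u) (pdiff None Q) \<noteq> 0"
    if "\<forall>l\<in>V. cmod (u l - t l) < \<epsilon>1" "y \<in> ?B" for y u
    using near[OF B\<epsilon>[OF that(2)] that(1)] a by (auto simp: norm_minus_commute)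
  have "simple_root_on (\<lambda>u. \<forall>l\<in>V. cmod (u l - t l) < \<epsilon>) Q c s"
    unfolding simple_root_on_def
  proof (intro exI[of _ "cmod a / 2"] conjI allI impI ballI a)
    fix u y y'
    assume u: "\<forall>l\<in>V. cmod (u l - t l) < \<epsilon>"
    then have u1: "\<forall>l\<in>V. cmod (u l - t l) < \<epsilon>1" using \<epsilon> by fastforce
    show "\<exists>y\<in>?B. ev (case_option y u) Q = 0" by (rule exist[OF u])
    assume y: "y \<in> ?B"
    show "ev (case_option y u) (pdiff None Q) \<noteq> 0" by (rule nz[OF u1 y])
    assume "y' \<in> ?B"
    then show "cmod a / 2 * cmod (y - y') \<le> cmod (ev (case_option y u) Q - ev (case_option y' u) Q)"
      by (rule lip[OF u1 y])
  qed
  then show ?thesis using that c(1) s(1) \<epsilon>(1) xB by blast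
qed

section \<open>Holomorphy of roots along complex lines\<close>

lemma isCont_ev_line:
  assumes "isCont F \<tau>0"
  shows "isCont (\<lambda>\<tau>. ev (case_option (F \<tau>) (\<lambda>l. a l + \<tau> * b l)) e) \<tau>0"
proof (induction e)
  case (Vr v)
  then show ?case by (cases v) (auto intro!: continuous_intros assms)
qed (auto intro!: continuous_intros)

text \<open>A divided difference that asks only continuity of \<open>F\<close>, since
  differentiability of the root is still to be proved. With the root as \<open>F\<close> both
  evaluations vanish, and the difference quotient becomes \<open>- A \<tau> / B \<tau>\<close>,
  where \<open>B \<tau>0\<close> is the nonzero partial derivative.\<close>

lemma ev_line_difference:
  assumes F: "isCont F \<tau>0"
  shows "\<exists>A B. isCont A \<tau>0 \<and> isCont B \<tau>0 \<and>
     B \<tau>0 = ev (case_option (F \<tau>0) (\<lambda>l. a l + \<tau>0 * b l)) (pdiff None e) \<and>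
     (\<forall>\<tau>. ev (case_option (F \<tau>) (\<lambda>l. a l + \<tau> * b l)) e - ev (case_option (F \<tau>0) (\<lambda>l. a l + \<tau>0 * b l)) e
        = A \<tau> * (\<tau> - \<tau>0) + B \<tau> * (F \<tau> - F \<tau>0))"
proof (induction e)
  case (Cst c)
  show ?case by (rule exI[of _ "\<lambda>_. 0"], rule exI[of _ "\<lambda>_. 0"]) auto
next
  case (Vr v)
  show ?case
  proof (cases v)
    case None
    show ?thesis unfolding None by (rule exI[of _ "\<lambda>_. 0"], rule exI[of _ "\<lambda>_. 1"]) auto
  next
    case (Some l)
    show ?thesis unfolding Some
      by (rule exI[of _ "\<lambda>_. b l"], rule exI[of _ "\<lambda>_. 0"]) (auto simp: algebra_simps)
  qed
next
  case (Ad e f)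
  then obtain A B A' B' where 1: "isCont A \<tau>0" "isCont B \<tau>0"
     "B \<tau>0 = ev (case_option (F \<tau>0) (\<lambda>l. a l + \<tau>0 * b l)) (pdiff None e)"
     "\<And>\<tau>. ev (case_option (F \<tau>) (\<lambda>l. a l + \<tau> * b l)) e - ev (case_option (F \<tau>0) (\<lambda>l. a l + \<tau>0 * b l)) e
        = A \<tau> * (\<tau> - \<tau>0) + B \<tau> * (F \<tau> - F \<tau>0)"
    and 2: "isCont A' \<tau>0" "isCont B' \<tau>0"
     "B' \<tau>0 = ev (case_option (F \<tau>0) (\<lambda>l. a l + \<tau>0 * b l)) (pdiff None f)"
     "\<And>\<tau>. ev (case_option (F \<tau>) (\<lambda>l. a l + \<tau> * b l)) f - ev (case_option (F \<tau>0) (\<lambda>l. a l + \<tau>0 * b l)) f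
        = A' \<tau> * (\<tau> - \<tau>0) + B' \<tau> * (F \<tau> - F \<tau>0)" by blast
  show ?case
  proof (rule exI[of _ "\<lambda>\<tau>. A \<tau> + A' \<tau>"], rule exI[of _ "\<lambda>\<tau>. B \<tau> + B' \<tau>"], intro conjI allI)
    fix \<tau>
    let ?E = "\<lambda>\<tau>. ev (case_option (F \<tau>) (\<lambda>l. a l + \<tau> * b l)) e"
    let ?G = "\<lambda>\<tau>. ev (case_option (F \<tau>) (\<lambda>l. a l + \<tau> * b l)) f"
    have "(?E \<tau> + ?G \<tau>) - (?E \<tau>0 + ?G \<tau>0) = (?E \<tau> - ?E \<tau>0) + (?G \<tau> - ?G \<tau>0)" by simp
    also have "\<dots> = (A \<tau> + A' \<tau>) * (\<tau> - \<tau>0) + (B \<tau> + B' \<tau>) * (F \<tau> - F \<tau>0)"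
      unfolding 1(4) 2(4) by (simp add: algebra_simps)
    finally show "ev (case_option (F \<tau>) (\<lambda>l. a l + \<tau> * b l)) (Ad e f) - ev (case_option (F \<tau>0) (\<lambda>l. a l + \<tau>0 * b l)) (Ad e f)
        = (A \<tau> + A' \<tau>) * (\<tau> - \<tau>0) + (B \<tau> + B' \<tau>) * (F \<tau> - F \<tau>0)"
      by simp
  qed (use 1 2 in \<open>auto intro!: continuous_intros\<close>)
next
  case (Ml e f)
  then obtain A B A' B' where 1: "isCont A \<tau>0" "isCont B \<tau>0"
     "B \<tau>0 = ev (case_option (F \<tau>0) (\<lambda>l. a l + \<tau>0 * b l)) (pdiff None e)"
     "\<And>\<tau>. ev (case_option (F \<tau>) (\<lambda>l. a l + \<tau> * b l)) e - ev (case_option (F \<tau>0) (\<lambda>l. a l + \<tau>0 * b l)) e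
        = A \<tau> * (\<tau> - \<tau>0) + B \<tau> * (F \<tau> - F \<tau>0)"
    and 2: "isCont A' \<tau>0" "isCont B' \<tau>0"
     "B' \<tau>0 = ev (case_option (F \<tau>0) (\<lambda>l. a l + \<tau>0 * b l)) (pdiff None f)"
     "\<And>\<tau>. ev (case_option (F \<tau>) (\<lambda>l. a l + \<tau> * b l)) f - ev (case_option (F \<tau>0) (\<lambda>l. a l + \<tau>0 * b l)) f
        = A' \<tau> * (\<tau> - \<tau>0) + B' \<tau> * (F \<tau> - F \<tau>0)" by blast
  let ?E = "\<lambda>\<tau>. ev (case_option (F \<tau>) (\<lambda>l. a l + \<tau> * b l)) e"
  let ?G = "\<lambda>\<tau>. ev (case_option (F \<tau>) (\<lambda>l. a l + \<tau> * b l)) f"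
  show ?case
  proof (rule exI[of _ "\<lambda>\<tau>. ?E \<tau> * A' \<tau> + ?G \<tau>0 * A \<tau>"],
      rule exI[of _ "\<lambda>\<tau>. ?E \<tau> * B' \<tau> + ?G \<tau>0 * B \<tau>"], intro conjI allI)
    fix \<tau>
    have "?E \<tau> * ?G \<tau> - ?E \<tau>0 * ?G \<tau>0 = ?E \<tau> * (?G \<tau> - ?G \<tau>0) + ?G \<tau>0 * (?E \<tau> - ?E \<tau>0)"
      by (simp add: algebra_simps)
    also have "\<dots> = (?E \<tau> * A' \<tau> + ?G \<tau>0 * A \<tau>) * (\<tau> - \<tau>0) + (?E \<tau> * B' \<tau> + ?G \<tau>0 * B \<tau>) * (F \<tau> - F \<tau>0)"
      unfolding 1(4) 2(4) by (simp add: algebra_simps)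
    finally show "ev (case_option (F \<tau>) (\<lambda>l. a l + \<tau> * b l)) (Ml e f) - ev (case_option (F \<tau>0) (\<lambda>l. a l + \<tau>0 * b l)) (Ml e f)
        = (?E \<tau> * A' \<tau> + ?G \<tau>0 * A \<tau>) * (\<tau> - \<tau>0) + (?E \<tau> * B' \<tau> + ?G \<tau>0 * B \<tau>) * (F \<tau> - F \<tau>0)"
      by simp
  qed (use 1 2 in \<open>auto intro!: continuous_intros isCont_ev_line F simp: algebra_simps\<close>)
qed

lemma rt_line_holomorphic:
  assumes root: "simple_root_on P Q c s" and "open \<Lambda>"
    and line: "\<And>\<tau>. \<tau> \<in> \<Lambda> \<Longrightarrow> P (\<lambda>l. a l + \<tau> * b l)"
  shows "(\<lambda>\<tau>. rt Q c s (\<lambda>l. a l + \<tau> * b l)) holomorphic_on \<Lambda>"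
proof -
  define G where "G \<tau> = rt Q c s (\<lambda>l. a l + \<tau> * b l)" for \<tau>
  obtain \<delta> where \<delta>: "\<delta> > 0" "\<And>u y y'. P u \<Longrightarrow> y \<in> ball (of_real c) s \<Longrightarrow> y' \<in> ball (of_real c) s \<Longrightarrow>
      \<delta> * cmod (y - y') \<le> cmod (ev (case_option y u) Q - ev (case_option y' u) Q)"
    using root unfolding simple_root_on_def by blast
  have G: "G \<tau> \<in> ball (of_real c) s" "ev (case_option (G \<tau>) (\<lambda>l. a l + \<tau> * b l)) Q = 0"
    "ev (case_option (G \<tau>) (\<lambda>l. a l + \<tau> * b l)) (pdiff None Q) \<noteq> 0" if "\<tau> \<in> \<Lambda>" for \<tau>
    using rt_root[OF root line[OF that]] by (auto simp: G_def)
  have "\<exists>D. (G has_field_derivative D) (at \<tau>0)" if \<tau>0: "\<tau>0 \<in> \<Lambda>" for \<tau>0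
  proof -
    have ev\<Lambda>: "\<forall>\<^sub>F \<tau> in at \<tau>0. \<tau> \<in> \<Lambda>"
      using \<open>open \<Lambda>\<close> \<tau>0 eventually_at_topological by blast
    have cont: "isCont G \<tau>0"
    proof -
      let ?K = "\<lambda>\<tau>. ev (case_option (G \<tau>0) (\<lambda>l. a l + \<tau> * b l)) Q"
      have "isCont ?K \<tau>0" by (rule isCont_ev_line) simp
      then have "(?K \<longlongrightarrow> 0) (at \<tau>0)" using G(2)[OF \<tau>0] by (simp add: isCont_def)
      then have lim: "((\<lambda>\<tau>. cmod (?K \<tau>) / \<delta>) \<longlongrightarrow> 0) (at \<tau>0)"
        using \<delta>(1) by (auto intro!: tendsto_eq_intros)
      have "\<forall>\<^sub>F \<tau> in at \<tau>0. norm (G \<tau> - G \<tau>0) \<le> cmod (?K \<tau>) / \<delta>"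
        using ev\<Lambda>
      proof eventually_elim
        case (elim \<tau>)
        have "\<delta> * cmod (G \<tau> - G \<tau>0) \<le> cmod (?K \<tau>)"
          using \<delta>(2)[OF line[OF elim] G(1)[OF elim] G(1)[OF \<tau>0]] G(2)[OF elim] by simp
        then show ?case using \<delta>(1) by (simp add: field_simps)
      qed
      then have "((\<lambda>\<tau>. G \<tau> - G \<tau>0) \<longlongrightarrow> 0) (at \<tau>0)" by (rule Lim_null_comparison[OF _ lim])
      then show ?thesis by (simp add: isCont_def LIM_zero_iff)
    qed
    obtain A B where AB: "isCont A \<tau>0" "isCont B \<tau>0" "B \<tau>0 \<noteq> 0"
      "\<And>\<tau>. \<tau> \<in> \<Lambda> \<Longrightarrow> A \<tau> * (\<tau> - \<tau>0) + B \<tau> * (G \<tau> - G \<tau>0) = 0"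
      using ev_line_difference[OF cont, of a b Q] G[OF \<tau>0] G(2) by auto
    have "\<forall>\<^sub>F \<tau> in at \<tau>0. B \<tau> \<noteq> 0"
      using AB(2,3) by (auto simp: isCont_def intro: tendsto_imp_eventually_ne)
    moreover have "\<forall>\<^sub>F \<tau> in at \<tau>0. \<tau> \<noteq> \<tau>0" by (simp add: eventually_at_filter)
    ultimately have quot: "\<forall>\<^sub>F \<tau> in at \<tau>0. - A \<tau> / B \<tau> = (G \<tau> - G \<tau>0) / (\<tau> - \<tau>0)"
      using ev\<Lambda>
    proof eventually_elim
      case (elim \<tau>)
      then have "B \<tau> * (G \<tau> - G \<tau>0) = - A \<tau> * (\<tau> - \<tau>0)"
        using AB(4)[of \<tau>] by (simp add: eq_neg_iff_add_eq_0 add.commute)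
      then show ?case using elim by (simp add: field_simps)
    qed
    have "((\<lambda>\<tau>. - A \<tau> / B \<tau>) \<longlongrightarrow> - A \<tau>0 / B \<tau>0) (at \<tau>0)"
      using AB(1-3) by (intro tendsto_intros) (simp_all add: isCont_def)
    then have "((\<lambda>\<tau>. (G \<tau> - G \<tau>0) / (\<tau> - \<tau>0)) \<longlongrightarrow> - A \<tau>0 / B \<tau>0) (at \<tau>0)"
      using quot by (rule Lim_transform_eventually)
    then show ?thesis unfolding has_field_derivative_iff by blast
  qed
  then have "G holomorphic_on \<Lambda>"
    unfolding holomorphic_on_open[OF \<open>open \<Lambda>\<close>] by blast
  then show ?thesis by (simp add: G_def[abs_def])
qed

text \<open>The sum factors as \<open>G \<tau> ^ m0 * R \<tau>\<close>, and
  \<open>R 0 = c m0 0\<close> because \<open>G 0 = 0\<close> kills the other terms. So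
  \<open>R\<close> has no zero near \<open>0\<close>, \<open>G\<close> vanishes there, and the
  identity theorem carries this to \<open>1\<close>.\<close>

lemma algebraic_relation_forces_zero:
  fixes G :: "complex \<Rightarrow> complex"
  assumes \<Lambda>: "open \<Lambda>" "connected \<Lambda>" "0 \<in> \<Lambda>" "1 \<in> \<Lambda>" and G: "G holomorphic_on \<Lambda>" "G 0 = 0"
    and c: "\<And>m. m \<le> D \<Longrightarrow> isCont (c m) 0"
    and m0: "m0 \<le> D" "c m0 0 \<noteq> 0" "\<And>m \<tau>. m < m0 \<Longrightarrow> \<tau> \<in> \<Lambda> \<Longrightarrow> c m \<tau> = 0"
    and rel: "\<And>\<tau>. \<tau> \<in> \<Lambda> \<Longrightarrow> (\<Sum>m\<le>D. c m \<tau> * G \<tau> ^ m) = 0"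
  shows "G 1 = 0"
proof -
  define R where "R \<tau> = (\<Sum>m=m0..D. c m \<tau> * G \<tau> ^ (m - m0))" for \<tau>
  have cG: "isCont G 0"
    using G \<Lambda> holomorphic_on_imp_continuous_on continuous_on_eq_continuous_at by blast
  have fac: "G \<tau> ^ m0 * R \<tau> = 0" if "\<tau> \<in> \<Lambda>" for \<tau>
  proof -
    have "(\<Sum>m\<le>D. c m \<tau> * G \<tau> ^ m) = (\<Sum>m=m0..D. c m \<tau> * G \<tau> ^ m)"
      using m0(3) that by (intro sum.mono_neutral_right) auto
    also have "\<dots> = G \<tau> ^ m0 * R \<tau>"
      unfolding R_def sum_distrib_left
    proof (rule sum.cong)
      fix m assume "m \<in> {m0..D}"
      then have "G \<tau> ^ m = G \<tau> ^ m0 * G \<tau> ^ (m - m0)" by (simp flip: power_add)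
      then show "c m \<tau> * G \<tau> ^ m = G \<tau> ^ m0 * (c m \<tau> * G \<tau> ^ (m - m0))" by simp
    qed simp
    finally show ?thesis using rel[OF that] by simp
  qed
  have R0: "R 0 = c m0 0"
  proof -
    have "R 0 = (\<Sum>m\<in>{m0..D}. if m = m0 then c m0 0 else 0)"
      unfolding R_def by (intro sum.cong) (auto simp: G(2) power_0_left)
    then show ?thesis using m0(1) by simp
  qed
  have "isCont R 0"
    unfolding R_def by (intro continuous_intros c cG) auto
  then have "(R \<longlongrightarrow> R 0) (nhds 0)" by (simp only: isCont_def tendsto_at_iff_tendsto_nhds)
  then have "\<forall>\<^sub>F \<tau> in nhds 0. R \<tau> \<noteq> 0"
    by (rule tendsto_imp_eventually_ne) (simp add: R0 m0(2))
  moreover have "\<forall>\<^sub>F \<tau> in nhds 0. \<tau> \<in> \<Lambda>" using \<Lambda> eventually_nhds by blast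
  ultimately have "\<forall>\<^sub>F \<tau> in nhds 0. \<tau> \<in> \<Lambda> \<and> G \<tau> = 0"
    by eventually_elim (use fac in auto)
  then obtain U where U: "open U" "0 \<in> U" "\<And>\<tau>. \<tau> \<in> U \<Longrightarrow> \<tau> \<in> \<Lambda> \<and> G \<tau> = 0"
    by (auto simp: eventually_nhds)
  show ?thesis
  proof (rule analytic_continuation[OF G(1) \<Lambda>(1,2) _ \<Lambda>(3) _ _ \<Lambda>(4)])
    show "U \<subseteq> \<Lambda>" using U(3) by blast
    show "0 islimpt U" using U(1,2) by (simp add: interior_limit_point interior_open)
    show "G z = 0" if "z \<in> U" for z using U(3)[OF that] by simp
  qed
qed

section \<open>Relations between roots at independent points\<close>

lemma poly_eq_sum_le:
  fixes p :: "complex poly"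
  assumes "degree p \<le> D"
  shows "poly p y = (\<Sum>m\<le>D. coeff p m * y ^ m)"
  unfolding poly_altdef using assms
  by (intro sum.mono_neutral_left) (auto simp: coeff_eq_0)

lemma convex_norm_affine_less:
  fixes \<alpha> \<beta> :: complex
  shows "convex {\<tau>. cmod (\<alpha> + \<tau> * \<beta>) < r}"
proof -
  have "linear (\<lambda>\<tau>. \<tau> * \<beta>)" by (simp add: linear_iff algebra_simps)
  then have "convex ((\<lambda>\<tau>. \<tau> * \<beta>) -` ball (- \<alpha>) r)" by (intro convex_linear_vimage) auto
  moreover have "(\<lambda>\<tau>. \<tau> * \<beta>) -` ball (- \<alpha>) r = {\<tau>. cmod (\<alpha> + \<tau> * \<beta>) < r}"
  proof -
    have "cmod (- \<alpha> - \<tau> * \<beta>) = cmod (\<alpha> + \<tau> * \<beta>)" for \<tau>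
      by (metis minus_add_distrib norm_minus_cancel diff_conv_add_uminus)
    then show ?thesis by (auto simp: dist_norm)
  qed
  ultimately show ?thesis by simp
qed

text \<open>The value of \<open>p\<close> at the roots is algebraic over the ring of polynomial
  functions over \<open>F\<close>, for which independence supplies genericity. Names
  \<open>s i l\<close> may repeat: equal entries of different tuples move together, while different
  names move freely.\<close>

lemma root_identity:
  fixes Q :: "'n \<Rightarrow> nat option pexpr" and s :: "nat \<Rightarrow> nat \<Rightarrow> 'w" and \<omega> :: "'w \<Rightarrow> real"
  assumes F: "{- 1, 0, 1} \<subseteq> F" and Q: "\<And>j. Q j \<in> over F (insert None (Some ` {..<d}))"
    and root: "\<And>j. simple_root_on (in_box d q r) (Q j) (c j) (z j)"
    and p: "p \<in> over F ({..<k} \<times> UNIV)"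
    and ind: "indep F W \<omega>" and sW: "\<And>i l. i < k \<Longrightarrow> l < d \<Longrightarrow> s i l \<in> W"
    and \<omega>b: "\<And>i. i < k \<Longrightarrow> in_box d q r (\<lambda>l. of_real (\<omega> (s i l)))"
    and vanish: "ev (\<lambda>(i, j). rt (Q j) (c j) (z j) (\<lambda>l. of_real (\<omega> (s i l)))) p = 0"
    and u: "\<And>i. i < k \<Longrightarrow> in_box d q r (\<lambda>l. u (s i l))"
  shows "ev (\<lambda>(i, j). rt (Q j) (c j) (z j) (\<lambda>l. u (s i l))) p = 0"
proof -
  define \<phi> where "\<phi> = (\<lambda>u (i, j). rt (Q j) (c j) (z j) (\<lambda>l. u (s i l)))"
  define \<Omega> where "\<Omega> = {u. \<forall>i<k. in_box d q r (\<lambda>l. u (s i l))}"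
  define S where "S = (\<lambda>e u. ev u e) ` over F W"
  define \<omega>' where "\<omega>' = (\<lambda>w. complex_of_real (\<omega> w))"
  interpret generic_ring S \<Omega> \<omega>'
  proof
    show "\<omega>' \<in> \<Omega>" using \<omega>b by (simp add: \<Omega>_def \<omega>'_def)
    show "(\<lambda>_. 1) \<in> S" unfolding S_def by (rule rev_image_eqI[of "Cst 1"]) (use F in auto)
  next
    fix f g assume "f \<in> S" "g \<in> S"
    then obtain a b where "a \<in> over F W" "f = (\<lambda>u. ev u a)" "b \<in> over F W" "g = (\<lambda>u. ev u b)"
      by (auto simp: S_def)
    then show "(\<lambda>u. f u + g u) \<in> S" "(\<lambda>u. f u * g u) \<in> S" unfolding S_def
      by - (rule rev_image_eqI[of "Ad a b"], auto, rule rev_image_eqI[of "Ml a b"], auto)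
  next
    fix f assume "f \<in> S"
    then obtain a where "a \<in> over F W" "f = (\<lambda>u. ev u a)" by (auto simp: S_def)
    then show "(\<lambda>u. - f u) \<in> S" unfolding S_def
      by (intro rev_image_eqI[of "Ml (Cst (- 1)) a"]) (use F in auto)
  next
    fix f u assume "f \<in> S" "f \<omega>' = 0" "u \<in> \<Omega>"
    then show "f u = 0" using ind by (auto simp: S_def indep_def \<omega>'_def)
  qed
  have alg_root: "alg_fun (\<lambda>u. \<phi> u (i, j))" if i: "i < k" for i j
  proof -
    let ?P = "\<lambda>v. upoly None (case_option 0 v) (Q j)"
    have opt: "(case_option 0 v)(None := y) = case_option y v" for y :: complex and v :: "nat \<Rightarrow> complex"
      by (auto split: option.split)
    obtain D where D: "\<And>u. degree (upoly None u (Q j)) \<le> D" using degree_upoly_bounded[of None "Q j"] by blast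
    have F': "{0, 1} \<subseteq> F" using F by auto
    have "\<forall>m. \<exists>a. a \<in> over F {..<d} \<and> (\<forall>v. ev v a = coeff (?P v) m)"
      using coeff_upoly_over[OF F' Q[of j]] by blast
    from choice[OF this] obtain a where
      a: "\<And>m. a m \<in> over F {..<d}" "\<And>m v. ev v (a m) = coeff (?P v) m" by blast
    define C where "C m = (\<lambda>u. ev u (psubst (\<lambda>l. Vr (s i l)) (a m)))" for m
    have C: "C m u = coeff (?P (\<lambda>l. u (s i l))) m" for m u
      by (simp add: C_def ev_psubst a(2))
    have CS: "C m \<in> S" for m
      unfolding C_def S_def by (intro imageI psubst_over[OF a(1)]) (use sW i in auto)
    have rel: "(\<Sum>m\<le>D. C m u * \<phi> u (i, j) ^ m) = 0" if "u \<in> \<Omega>" for u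
    proof -
      have b: "in_box d q r (\<lambda>l. u (s i l))" using that i by (simp add: \<Omega>_def)
      have "(\<Sum>m\<le>D. C m u * \<phi> u (i, j) ^ m) = poly (?P (\<lambda>l. u (s i l))) (\<phi> u (i, j))"
        unfolding C by (rule poly_eq_sum_le[OF D, symmetric])
      also have "\<dots> = ev (case_option (\<phi> u (i, j)) (\<lambda>l. u (s i l))) (Q j)"
        by (simp add: poly_upoly opt)
      also have "\<dots> = 0" using rt_root(2)[OF root b] by (simp add: \<phi>_def)
      finally show ?thesis .
    qed
    have b: "in_box d q r (\<lambda>l. \<omega>' (s i l))" using \<omega>b[OF i] by (simp add: \<omega>'_def)
    let ?p = "?P (\<lambda>l. \<omega>' (s i l))"
    \<comment> \<open>Simplicity of the root shows that the polynomial does not degenerate at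
      \<open>\<omega>'\<close>; its leading coefficient is then the required nonzero value.\<close>
    have "poly (pderiv ?p) (\<phi> \<omega>' (i, j)) \<noteq> 0"
      using rt_root(3)[OF root b] by (simp add: pderiv_upoly poly_upoly opt \<phi>_def)
    then have "?p \<noteq> 0" by auto
    then have "C (degree ?p) \<omega>' \<noteq> 0" unfolding C by simp
    then show ?thesis
      unfolding alg_fun_def using CS rel D by blast
  qed
  have alg: "alg_fun (\<lambda>u. ev (\<phi> u) e)" if "e \<in> over F ({..<k} \<times> UNIV)" for e
    using that
  proof (induction e)
    case (Cst x)
    then have "(\<lambda>_. of_real x) \<in> S" unfolding S_def by (intro rev_image_eqI[of "Cst x"]) auto
    then show ?case using alg_fun_ring by simp
  next
    case (Vr v)
    then show ?case using alg_root by (cases v) auto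
  qed (auto intro: alg_fun_add_mult)
  obtain D C where C: "\<forall>m\<le>D. C m \<in> S" "\<exists>m\<le>D. C m \<omega>' \<noteq> 0"
    "\<forall>u\<in>\<Omega>. (\<Sum>m\<le>D. C m u * ev (\<phi> u) p ^ m) = 0"
    using alg[OF p] unfolding alg_fun_def by blast
  define m0 where "m0 = (LEAST m. m \<le> D \<and> C m \<omega>' \<noteq> 0)"
  have m0: "m0 \<le> D \<and> C m0 \<omega>' \<noteq> 0" unfolding m0_def by (rule LeastI_ex) (use C(2) in blast)
  have below: "C m v = 0" if "m < m0" "v \<in> \<Omega>" for m v
  proof (rule generic[OF _ _ that(2)])
    show "C m \<in> S" using C(1) m0 that(1) by auto
    show "C m \<omega>' = 0" using not_less_Least[of m "\<lambda>m. m \<le> D \<and> C m \<omega>' \<noteq> 0"] that(1) m0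
      by (auto simp: m0_def[symmetric])
  qed
  \<comment> \<open>The line through \<open>\<omega>'\<close> at \<open>0\<close> and
    \<open>u\<close> at \<open>1\<close>. The parameters that keep it in the polydiscs form an open
    convex set, which is a domain for the identity theorem.\<close>
  define L where "L \<tau> w = \<omega>' w + \<tau> * (u w - \<omega>' w)" for \<tau> w
  define \<Lambda> where "\<Lambda> = {\<tau>. L \<tau> \<in> \<Omega>}"
  have L01: "L 0 = \<omega>'" "L 1 = u" by (auto simp: L_def)
  have \<Lambda>_eq: "\<Lambda> = (\<Inter>i\<in>{..<k}. \<Inter>l\<in>{..<d}.
      {\<tau>. cmod ((\<omega>' (s i l) - of_real (q ! l)) + \<tau> * (u (s i l) - \<omega>' (s i l))) < r})"
    by (auto simp: \<Lambda>_def \<Omega>_def in_box_def L_def algebra_simps)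
  have op: "open \<Lambda>"
    unfolding \<Lambda>_eq by (intro open_INT ballI finite_lessThan open_Collect_less continuous_intros)
  have "convex \<Lambda>"
    unfolding \<Lambda>_eq by (intro convex_INT convex_norm_affine_less)
  then have con: "connected \<Lambda>" by (rule convex_connected)
  have in01: "0 \<in> \<Lambda>" "1 \<in> \<Lambda>"
    using generic_in u by (auto simp: \<Lambda>_def L01 \<Omega>_def)
  have hol: "(\<lambda>\<tau>. ev (\<phi> (L \<tau>)) p) holomorphic_on \<Lambda>"
    using p
  proof (induction p)
    case (Vr v)
    then obtain i j where v: "v = (i, j)" "i < k" by auto
    have "(\<lambda>\<tau>. rt (Q j) (c j) (z j) (\<lambda>l. \<omega>' (s i l) + \<tau> * (u (s i l) - \<omega>' (s i l)))) holomorphic_on \<Lambda>"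
      by (rule rt_line_holomorphic[OF root op])
        (use v(2) in \<open>simp add: \<Lambda>_def \<Omega>_def L_def\<close>)
    then show ?case by (simp add: v \<phi>_def L_def)
  qed (auto intro!: holomorphic_intros)
  have at0: "ev (\<phi> (L 0)) p = 0" using vanish by (simp add: L01 \<phi>_def \<omega>'_def)
  have cont: "isCont (\<lambda>\<tau>. C m (L \<tau>)) 0" if "m \<le> D" for m
  proof -
    have "C m \<in> (\<lambda>e u. ev u e) ` over F W" using C(1) that by (simp add: S_def)
    then obtain e where e: "e \<in> over F W" "C m = (\<lambda>u. ev u e)" by blast
    show ?thesis
      unfolding isCont_def e(2)
      by (rule ev_tendsto[OF e(1)]) (auto simp: L_def intro!: tendsto_eq_intros)
  qed
  have nz: "C m0 (L 0) \<noteq> 0" using m0 by (simp add: L01)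
  have low: "C m (L \<tau>) = 0" if "m < m0" "\<tau> \<in> \<Lambda>" for m \<tau>
    using below that by (simp add: \<Lambda>_def)
  have rel: "(\<Sum>m\<le>D. C m (L \<tau>) * ev (\<phi> (L \<tau>)) p ^ m) = 0" if "\<tau> \<in> \<Lambda>" for \<tau>
    using C(3) that by (simp add: \<Lambda>_def)
  have "ev (\<phi> (L 1)) p = 0"
    by (rule algebraic_relation_forces_zero[OF op con in01 hol at0 cont conjunct1[OF m0] nz low rel])
  then show ?thesis by (simp add: L01 \<phi>_def)
qed

text \<open>If the two points were equal, their equality would persist under every change of the
  independent elements. By \<open>sep\<close> no element occurs at two positions, so the tuples can
  be moved to \<open>v\<close> and \<open>v(l0 := a)\<close>, whose values differ in coordinate
  \<open>j0\<close>.\<close>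

lemma root_tuples_distinct:
  fixes Q :: "'n \<Rightarrow> nat option pexpr" and \<sigma> \<sigma>' :: "nat \<Rightarrow> 'w" and \<omega> :: "'w \<Rightarrow> real"
  assumes F: "{- 1, 0, 1} \<subseteq> F" and Q: "\<And>j. Q j \<in> over F (insert None (Some ` {..<d}))"
    and root: "\<And>j. simple_root_on (in_box d q r) (Q j) (c j) (z j)"
    and ind: "indep F W \<omega>" and W: "\<And>l. l < d \<Longrightarrow> \<sigma> l \<in> W" "\<And>l. l < d \<Longrightarrow> \<sigma>' l \<in> W"
    and b: "in_box d q r (\<lambda>l. of_real (\<omega> (\<sigma> l)))" "in_box d q r (\<lambda>l. of_real (\<omega> (\<sigma>' l)))"
    and sep: "\<And>l m. l < d \<Longrightarrow> m < d \<Longrightarrow> \<sigma> l = \<sigma> m \<or> \<sigma>' l = \<sigma>' m \<or> \<sigma> l = \<sigma>' m \<Longrightarrow> l = m"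
    and l0: "l0 < d" "\<sigma> l0 \<noteq> \<sigma>' l0"
    and dep: "in_box d q r v" "in_box d q r (v(l0 := a))"
      "rt (Q j0) (c j0) (z j0) v \<noteq> rt (Q j0) (c j0) (z j0) (v(l0 := a))"
  shows "\<exists>j. rt (Q j) (c j) (z j) (\<lambda>l. of_real (\<omega> (\<sigma> l))) \<noteq> rt (Q j) (c j) (z j) (\<lambda>l. of_real (\<omega> (\<sigma>' l)))"
proof (rule ccontr)
  assume "\<not> ?thesis"
  then have eq: "rt (Q j) (c j) (z j) (\<lambda>l. of_real (\<omega> (\<sigma> l))) = rt (Q j) (c j) (z j) (\<lambda>l. of_real (\<omega> (\<sigma>' l)))" for j
    by blast
  define s where "s i = (if i = 0 then \<sigma> else \<sigma>')" for i :: nat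
  define v' where "v' = v(l0 := a)"
  \<comment> \<open>Names in \<open>\<sigma>\<close> take their values from \<open>v\<close>, the
    others from \<open>v'\<close>. A shared name has the same position in both tuples, and not
    \<open>l0\<close>, so \<open>v\<close> and \<open>v'\<close> agree there.\<close>
  define u where "u w = (if \<exists>l<d. \<sigma> l = w then v (THE l. l < d \<and> \<sigma> l = w) else v' (THE l. l < d \<and> \<sigma>' l = w))" for w
  have u1: "u (\<sigma> l) = v l" if "l < d" for l
  proof -
    have "(THE m. m < d \<and> \<sigma> m = \<sigma> l) = l" using that sep by (intro the_equality) auto
    then show ?thesis using that by (auto simp: u_def)
  qed
  have u2: "u (\<sigma>' l) = v' l" if l: "l < d" for l
  proof (cases "\<exists>m<d. \<sigma> m = \<sigma>' l")
    case True
    then obtain m where m: "m < d" "\<sigma> m = \<sigma>' l" by blast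
    then have "m = l" using sep l by blast
    with m l0 have "\<sigma> l = \<sigma>' l" "l \<noteq> l0" by auto
    then show ?thesis using u1[OF l] by (simp add: v'_def)
  next
    case False
    have "(THE m. m < d \<and> \<sigma>' m = \<sigma>' l) = l" using l sep by (intro the_equality) auto
    then show ?thesis using False by (auto simp: u_def)
  qed
  let ?p = "Ad (Vr (0 :: nat, j0)) (Ml (Cst (- 1)) (Vr (1, j0)))"
  have "ev (\<lambda>(i, j). rt (Q j) (c j) (z j) (\<lambda>l. u (s i l))) ?p = 0"
  proof (rule root_identity[OF F Q root _ ind, where k = 2])
    show "?p \<in> over F ({..<2} \<times> UNIV)" using F by auto
    show "s i l \<in> W" if "i < 2" "l < d" for i l using W that by (auto simp: s_def)
    show "in_box d q r (\<lambda>l. of_real (\<omega> (s i l)))" if "i < 2" for i using b by (auto simp: s_def)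
    show "ev (\<lambda>(i, j). rt (Q j) (c j) (z j) (\<lambda>l. of_real (\<omega> (s i l)))) ?p = 0"
      using eq[of j0] by (simp add: s_def)
    show "in_box d q r (\<lambda>l. u (s i l))" if "i < 2" for i
      using dep(1,2) u1 u2 by (auto simp: s_def in_box_def v'_def[symmetric])
  qed
  then have "rt (Q j0) (c j0) (z j0) (\<lambda>l. u (\<sigma> l)) = rt (Q j0) (c j0) (z j0) (\<lambda>l. u (\<sigma>' l))"
    by (simp add: s_def)
  moreover have "rt (Q j0) (c j0) (z j0) (\<lambda>l. u (\<sigma> l)) = rt (Q j0) (c j0) (z j0) v"
    by (rule rt_cong[OF Q]) (rule u1)
  moreover have "rt (Q j0) (c j0) (z j0) (\<lambda>l. u (\<sigma>' l)) = rt (Q j0) (c j0) (z j0) v'"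
    by (rule rt_cong[OF Q]) (rule u2)
  ultimately show False using dep(3) by (simp add: v'_def)
qed

section \<open>Points as values of algebraic functions at independent parameters\<close>

text \<open>A chain rule for the two substitutions needed: renaming parameters and replacing a
  parameter by a constant.\<close>

lemma pdiff_psubst:
  assumes "\<And>v. ev u (pdiff z' (s v)) = (if v = z then 1 else 0)"
  shows "ev u (pdiff z' (psubst s e)) = ev u (psubst s (pdiff z e))"
  by (induction e) (simp_all add: assms)

text \<open>The data tuple is what a colour records besides information on \<open>t\<close>. The
  real intervals are disjoint so that the position of an entry can be read off from its value; hence
  tuples with equal data share entries only at equal positions. The last clause, dependence on every
  parameter, keeps points distinct after their parameters are moved.\<close>

definition represents :: "real set \<Rightarrow> real set \<Rightarrow> real^'n::finite \<Rightarrow>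
    nat \<times> real list \<times> real \<times> ('n \<Rightarrow> nat option pexpr) \<times> ('n \<Rightarrow> real) \<times> ('n \<Rightarrow> real) \<Rightarrow>
    (nat \<Rightarrow> real) \<Rightarrow> bool" where
  "represents F T x = (\<lambda>(d, q, r, Q, c, z) t.
     inj_on t {..<d} \<and> t ` {..<d} \<subseteq> T \<and> length q = d \<and> set q \<subseteq> \<rat> \<and> r \<in> \<rat> \<and> r > 0 \<and>
     range c \<subseteq> \<rat> \<and> range z \<subseteq> \<rat> \<and>
     (\<forall>j. Q j \<in> over F (insert None (Some ` {..<d})) \<and>
        simple_root_on (in_box d q r) (Q j) (c j) (z j) \<and>
        rt (Q j) (c j) (z j) (\<lambda>l. of_real (t l)) = of_real (x $ j)) \<and>
     in_box d q r (\<lambda>l. of_real (t l)) \<and>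
     (\<forall>l<d. \<forall>m<d. \<forall>y::real. \<bar>y - q ! l\<bar> < r \<longrightarrow> \<bar>y - q ! m\<bar> < r \<longrightarrow> l = m) \<and>
     (\<forall>l<d. \<exists>u a j. in_box d q r u \<and> in_box d q r (u(l := a)) \<and>
        rt (Q j) (c j) (z j) u \<noteq> rt (Q j) (c j) (z j) (u(l := a))))"

lemma represents_exists:
  fixes x :: "real^'n::finite"
  assumes F: "\<rat> \<subseteq> F" and alg: "\<And>x. \<exists>W. finite W \<and> W \<subseteq> T \<and> algebraic_over F W x"
  shows "\<exists>D t. represents F T x D t"
proof -
  have F01: "{0, 1} \<subseteq> F" using F by auto
  define good where "good W \<longleftrightarrow> finite W \<and> W \<subseteq> T \<and> (\<forall>j. algebraic_over F W (x $ j))" for W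
  have "\<forall>j. \<exists>W. finite W \<and> W \<subseteq> T \<and> algebraic_over F W (x $ j)" using alg by blast
  from choice[OF this] obtain W0 where
    W0: "\<And>j. finite (W0 j)" "\<And>j. W0 j \<subseteq> T" "\<And>j. algebraic_over F (W0 j) (x $ j)" by blast
  have "good (\<Union>j. W0 j)"
    unfolding good_def
  proof (intro conjI allI)
    show "finite (\<Union>j. W0 j)" "(\<Union>j. W0 j) \<subseteq> T" using W0(1,2) by auto
    show "algebraic_over F (\<Union>j. W0 j) (x $ j)" for j
      by (rule algebraic_over_mono[OF W0(3)[of j]]) blast
  qed
  then obtain W where W: "good W" and min: "\<And>V. good V \<Longrightarrow> card W \<le> card V"
    using arg_min_nat_lemma[of good _ card] by (metis (no_types, lifting))
  define d where "d = card W"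
  have finW: "finite W" and WT: "W \<subseteq> T" using W by (auto simp: good_def)
  obtain t where t: "bij_betw t {..<d} W"
    using ex_bij_betw_nat_finite[OF finW] by (auto simp: d_def atLeast0LessThan)
  define ti where "ti = the_inv_into {..<d} t"
  have tinj: "inj_on t {..<d}" and tW: "t ` {..<d} = W" using t by (auto simp: bij_betw_def)
  have ti: "ti w < d" "t (ti w) = w" if "w \<in> W" for w
    using that tW the_inv_into_into[OF tinj, of w "{..<d}"] f_the_inv_into_f[OF tinj, of w]
    by (auto simp: ti_def)
  let ?t = "\<lambda>l. complex_of_real (t l)"
  have "\<exists>Q. Q \<in> over F (insert None (Some ` {..<d})) \<and> ev (case_option (of_real (x $ j)) ?t) Q = 0 \<and>
     ev (case_option (of_real (x $ j)) ?t) (pdiff None Q) \<noteq> 0" for j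
  proof -
    have "algebraic_over F W (x $ j)" using W by (simp add: good_def)
    then obtain e where e: "e \<in> over F (insert None (Some ` W))"
      "ev (case_option (of_real (x $ j)) of_real) e = 0"
      "ev (case_option (of_real (x $ j)) of_real) (pdiff None e) \<noteq> 0"
      using algebraic_over_simple_root[OF F01] by blast
    let ?s = "\<lambda>v. Vr (map_option ti v)"
    have sub: "ev (case_option y ?t) (psubst ?s e') = ev (case_option y of_real) e'"
      if e': "e' \<in> over F (insert None (Some ` W))" for y e'
      unfolding ev_psubst by (rule ev_cong[OF e']) (use ti in auto)
    have "ev (case_option y ?t) (pdiff None (psubst ?s e)) = ev (case_option y ?t) (psubst ?s (pdiff None e))" for y
      by (rule pdiff_psubst) auto
    then have "ev (case_option (of_real (x $ j)) ?t) (pdiff None (psubst ?s e)) \<noteq> 0"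
      using sub[OF pdiff_over[OF F01 e(1)]] e(3) by simp
    moreover have "psubst ?s e \<in> over F (insert None (Some ` {..<d}))"
      by (rule psubst_over[OF e(1)]) (use ti in auto)
    ultimately show ?thesis using sub[OF e(1)] e(2) by auto
  qed
  then have "\<forall>j. \<exists>Q. Q \<in> over F (insert None (Some ` {..<d})) \<and> ev (case_option (of_real (x $ j)) ?t) Q = 0 \<and>
     ev (case_option (of_real (x $ j)) ?t) (pdiff None Q) \<noteq> 0" by blast
  from choice[OF this] obtain Q where Q: "\<And>j. Q j \<in> over F (insert None (Some ` {..<d}))"
    "\<And>j. ev (case_option (of_real (x $ j)) ?t) (Q j) = 0"
    "\<And>j. ev (case_option (of_real (x $ j)) ?t) (pdiff None (Q j)) \<noteq> 0" by blast
  have "\<forall>j. \<exists>p. fst p \<in> \<rat> \<and> fst (snd p) \<in> \<rat> \<and> snd (snd p) > 0 \<and>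
      of_real (x $ j) \<in> ball (complex_of_real (fst p)) (fst (snd p)) \<and>
      simple_root_on (\<lambda>u. \<forall>l\<in>{..<d}. cmod (u l - ?t l) < snd (snd p)) (Q j) (fst p) (fst (snd p))"
  proof
    fix j
    obtain c s \<epsilon> where "c \<in> \<rat>" "s \<in> \<rat>" "\<epsilon> > 0" "of_real (x $ j) \<in> ball (complex_of_real c) s"
      "simple_root_on (\<lambda>u. \<forall>l\<in>{..<d}. cmod (u l - ?t l) < \<epsilon>) (Q j) c s"
      by (rule simple_root_local[OF Q(1) F01 Q(2,3)])
    then show "\<exists>p. fst p \<in> \<rat> \<and> fst (snd p) \<in> \<rat> \<and> snd (snd p) > 0 \<and>
      of_real (x $ j) \<in> ball (complex_of_real (fst p)) (fst (snd p)) \<and>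
      simple_root_on (\<lambda>u. \<forall>l\<in>{..<d}. cmod (u l - ?t l) < snd (snd p)) (Q j) (fst p) (fst (snd p))"
      by (intro exI[of _ "(c, s, \<epsilon>)"]) simp
  qed
  from choice[OF this] obtain p where p: "\<And>j. fst (p j) \<in> \<rat>" "\<And>j. fst (snd (p j)) \<in> \<rat>"
    "\<And>j. snd (snd (p j)) > 0" "\<And>j. of_real (x $ j) \<in> ball (complex_of_real (fst (p j))) (fst (snd (p j)))"
    "\<And>j. simple_root_on (\<lambda>u. \<forall>l\<in>{..<d}. cmod (u l - ?t l) < snd (snd (p j))) (Q j) (fst (p j)) (fst (snd (p j)))"
    by blast
  define c where "c j = fst (p j)" for j
  define z where "z j = fst (snd (p j))" for j
  \<comment> \<open>Half of a radius, because points of the box are within \<open>2 * r\<close> of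
    \<open>t\<close>; a quarter of a gap, because a number in two of the intervals would bring
    \<open>t l\<close> and \<open>t m\<close> within \<open>4 * r\<close>.\<close>
  define M where "M = (\<lambda>j. snd (snd (p j)) / 2) ` UNIV \<union> (\<lambda>(l, m). \<bar>t l - t m\<bar> / 4) ` {(l, m). l < d \<and> m < d \<and> l \<noteq> m}"
  have "finite {(l, m). l < d \<and> m < d \<and> l \<noteq> m}"
    by (rule finite_subset[of _ "{..<d} \<times> {..<d}"]) auto
  then have finM: "finite M" "M \<noteq> {}" by (auto simp: M_def)
  have "\<forall>y\<in>M. y > 0" using p(3) tinj by (auto simp: M_def inj_on_def)
  then have "Min M > 0" using finM by simp
  then obtain r where r: "r \<in> \<rat>" "0 < r" "r < Min M" using Rats_dense_in_real by blast
  have rM: "r < y" if "y \<in> M" for y using r(3) Min_le[OF finM(1) that] by simp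
  have "\<forall>l. \<exists>y. y \<in> \<rat> \<and> \<bar>y - t l\<bar> < r"
  proof
    fix l
    obtain y where "y \<in> \<rat>" "t l < y" "y < t l + r" using Rats_dense_in_real[of "t l" "t l + r"] r by auto
    then show "\<exists>y. y \<in> \<rat> \<and> \<bar>y - t l\<bar> < r" by (intro exI[of _ y]) auto
  qed
  from choice[OF this] obtain y where y: "\<And>l. y l \<in> \<rat>" "\<And>l. \<bar>y l - t l\<bar> < r" by blast
  define q where "q = map y [0..<d]"
  have q: "q ! l = y l" if "l < d" for l using that by (simp add: q_def)
  have root: "simple_root_on (in_box d q r) (Q j) (c j) (z j)" for j
    unfolding c_def z_def
  proof (rule simple_root_on_mono[OF p(5)], rule ballI)
    fix u l assume u: "in_box d q r u" and l: "l \<in> {..<d}"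
    have "cmod (u l - ?t l) \<le> cmod (u l - of_real (q ! l)) + cmod (of_real (y l) - ?t l)"
      using norm_triangle_ineq[of "u l - of_real (y l)" "of_real (y l) - ?t l"] q l by simp
    also have "cmod (of_real (y l) - ?t l) = \<bar>y l - t l\<bar>" by (simp flip: of_real_diff)
    also have "cmod (u l - of_real (q ! l)) < r" using u l by (simp add: in_box_def)
    finally have "cmod (u l - ?t l) < 2 * r" using y(2)[of l] by linarith
    moreover have "r < snd (snd (p j)) / 2" by (rule rM) (auto simp: M_def)
    ultimately show "cmod (u l - ?t l) < snd (snd (p j))" by linarith
  qed
  have tb: "in_box d q r ?t"
    unfolding in_box_def
  proof (intro allI impI)
    fix l assume "l < d"
    then have "cmod (?t l - of_real (q ! l)) = \<bar>t l - y l\<bar>" by (simp add: q flip: of_real_diff)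
    then show "cmod (?t l - of_real (q ! l)) < r" using y(2)[of l] by simp
  qed
  have rtx: "rt (Q j) (c j) (z j) ?t = of_real (x $ j)" for j
    by (rule rt_unique[OF root tb]) (use p(4) Q(2) in \<open>auto simp: c_def z_def\<close>)
  have dep: "\<exists>u a j. in_box d q r u \<and> in_box d q r (u(l := a)) \<and>
        rt (Q j) (c j) (z j) u \<noteq> rt (Q j) (c j) (z j) (u(l := a))" if l: "l < d" for l
  proof (rule ccontr)
    \<comment> \<open>If no root depends on parameter \<open>l\<close>, the rational
      \<open>q ! l\<close> can replace \<open>t l\<close> without changing \<open>x\<close>. Then
      all coordinates are algebraic over \<open>W - {t l}\<close>, against the minimality of
      \<open>card W\<close>.\<close>
    assume neg: "\<not> ?thesis"
    let ?t' = "?t(l := of_real (q ! l))"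
    have tb': "in_box d q r ?t'" using tb r(2) by (auto simp: in_box_def)
    have rt': "rt (Q j) (c j) (z j) ?t' = of_real (x $ j)" for j
      using neg tb tb' rtx by metis
    have "algebraic_over F (W - {t l}) (x $ j)" for j
    proof -
      let ?s = "\<lambda>v. case v of None \<Rightarrow> Vr None | Some m \<Rightarrow> if m = l then Cst (q ! l) else Vr (Some (t m))"
      let ?e = "psubst ?s (Q j)"
      have ev: "ev (case_option y of_real) (psubst ?s e) = ev (case_option y ?t') e" for y e
      proof -
        have "(\<lambda>v. ev (case_option y of_real) (?s v)) = case_option y ?t'"
          by (auto split: option.split)
        then show ?thesis by (simp add: ev_psubst)
      qed
      have opt: "(case_option 0 of_real)(None := y) = case_option y of_real" for y :: complex
        by (auto split: option.split)
      have ql: "q ! l \<in> F" using y(1) q[OF l] F by auto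
      have "?e \<in> over F (insert None (Some ` (W - {t l})))"
      proof (rule psubst_over[OF Q(1)])
        fix v assume v: "v \<in> insert None (Some ` {..<d})"
        show "?s v \<in> over F (insert None (Some ` (W - {t l})))"
        proof (cases v)
          case (Some m)
          then have "m < d" using v by auto
          then have "t m \<in> W - {t l}" if "m \<noteq> l" using tW tinj l that by (auto simp: inj_on_def)
          then show ?thesis using ql Some by auto
        qed simp
      qed
      moreover have "ev (case_option (of_real (x $ j)) of_real) ?e = 0"
        using rt_root(2)[OF root tb'] by (simp only: ev rt')
      moreover have "upoly None (case_option 0 of_real) ?e \<noteq> 0"
      proof
        assume "upoly None (case_option 0 of_real) ?e = 0"
        then have "poly (pderiv (upoly None (case_option 0 of_real) ?e)) (of_real (x $ j)) = 0" by simp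
        then have "ev (case_option (of_real (x $ j)) of_real) (pdiff None ?e) = 0"
          by (simp only: pderiv_upoly poly_upoly opt)
        moreover have "ev (case_option (of_real (x $ j)) of_real) (pdiff None ?e) =
            ev (case_option (of_real (x $ j)) of_real) (psubst ?s (pdiff None (Q j)))"
          by (rule pdiff_psubst) (auto split: option.split)
        ultimately have "ev (case_option (of_real (x $ j)) ?t') (pdiff None (Q j)) = 0" by (simp only: ev)
        then show False using rt_root(3)[OF root tb'] by (simp only: rt')
      qed
      ultimately show ?thesis unfolding algebraic_over_def by blast
    qed
    then have "good (W - {t l})" using W by (auto simp: good_def)
    then have "card W \<le> card (W - {t l})" by (rule min)
    moreover have "t l \<in> W" using tW l by auto
    ultimately show False using finW by (metis card_Diff1_less not_less)
  qed
  have sep: "l = m" if lm: "l < d" "m < d" and v: "\<bar>v - q ! l\<bar> < r" "\<bar>v - q ! m\<bar> < r" for l m and v :: real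
  proof (rule ccontr)
    assume "l \<noteq> m"
    then have "r < \<bar>t l - t m\<bar> / 4" using lm by (intro rM) (auto simp: M_def)
    then show False using v y(2)[of l] y(2)[of m] q lm by (auto simp: abs_if split: if_splits)
  qed
  have "represents F T x (d, q, r, Q, c, z) t"
    unfolding represents_def prod.case
    using tinj tW WT y(1) r(1,2) p(1,2) Q(1) root rtx tb sep dep
    by (intro conjI allI impI) (auto simp: q_def c_def z_def)
  then show ?thesis by blast
qed

section \<open>Transfer of monochromatic edges\<close>

text \<open>The condition on \<open>card (J d c)\<close> is exactly what a grid on these coordinates
  requires. For the least \<open>N\<close> with \<open>small K N X\<close>, a set of
  \<open>Suc n\<close> named coordinates has \<open>n < N\<close>; if there is no such
  \<open>N\<close>, all coordinates can be named and the colour can be constant.\<close>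

lemma grid_determining_coloring:
  fixes K :: "'c set" and X :: "'a set"
  assumes K: "infinite K"
  shows "\<exists>\<phi> J. \<forall>d :: nat.
     (\<forall>x. (\<forall>l<d. x l \<in> X) \<longrightarrow> \<phi> d x \<in> K) \<and>
     (\<forall>c. J d c \<subseteq> {..<d} \<and> (\<forall>n. card (J d c) = Suc n \<longrightarrow> \<not> small K n X)) \<and>
     (\<forall>x y. (\<forall>l<d. x l \<in> X) \<longrightarrow> (\<forall>l<d. y l \<in> X) \<longrightarrow> \<phi> d x = \<phi> d y \<longrightarrow>
        (\<forall>l\<in>J d (\<phi> d x). x l = y l) \<longrightarrow> (\<forall>l<d. x l = y l))"
proof (cases "\<exists>n. small K n X")
  case True
  define N where "N = (LEAST n. small K n X)"
  have N: "small K N X" unfolding N_def using True by (rule LeastI_ex)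
  have less: "\<not> small K n X" if "n < N" for n using not_less_Least that unfolding N_def by blast
  let ?P = "\<lambda>(d :: nat) \<phi> J. (\<forall>x. (\<forall>l<d. x l \<in> X) \<longrightarrow> \<phi> x \<in> K) \<and>
     (\<forall>c. J c \<subseteq> {..<d} \<and> card (J c) \<le> N) \<and>
     (\<forall>x y. (\<forall>l<d. x l \<in> X) \<longrightarrow> (\<forall>l<d. y l \<in> X) \<longrightarrow> \<phi> x = \<phi> y \<longrightarrow>
        (\<forall>l\<in>J (\<phi> x). x l = y l) \<longrightarrow> (\<forall>l<d. x l = y l))"
  have "\<forall>d. \<exists>\<phi> J. ?P d \<phi> J" by (intro allI small_determining_coloring[OF K N])
  from choice[OF this] obtain \<phi> where "\<forall>d. \<exists>J. ?P d (\<phi> d) J" ..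
  from choice[OF this] obtain J where J: "\<forall>d. ?P d (\<phi> d) (J d)" ..
  have "\<not> small K n X" if "card (J d c) = Suc n" for d c n
  proof (rule less)
    have "card (J d c) \<le> N" using J by blast
    with that show "n < N" by simp
  qed
  with J show ?thesis by (intro exI[of _ \<phi>] exI[of _ J]) blast
next
  case False
  obtain k where "k \<in> K" using K by fastforce
  with False show ?thesis by (intro exI[of _ "\<lambda>_ _. k"] exI[of _ "\<lambda>d _. {..<d}"]) auto
qed

lemma algebraic_hypergraph_pexpr:
  assumes "algebraic_hypergraph E"
  shows "\<exists>k e. 2 \<le> k \<and> finite (csts e) \<and> pvars e \<subseteq> {..<k} \<times> UNIV \<and>
     E = {S. \<exists>a :: nat \<Rightarrow> real^'a::finite. inj_on a {..<k} \<and> S = a ` {..<k} \<and>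
           ev (\<lambda>(i, j). of_real (a i $ j)) e = 0}"
proof -
  obtain k p where kp: "2 \<le> k" "real_polyfun ({..<k} \<times> (UNIV :: 'a set)) p"
    "E = {S. \<exists>a :: nat \<Rightarrow> real^'a. inj_on a {..<k} \<and> S = a ` {..<k} \<and> p (\<lambda>(i, j). a i $ j) = 0}"
    using assms by (auto simp: algebraic_hypergraph_def)
  obtain e where e: "pvars e \<subseteq> {..<k} \<times> UNIV" "finite (csts e)"
    "\<And>x. ev (\<lambda>v. of_real (x v)) e = of_real (p x)"
    using real_polyfun_pexpr[OF kp(2)] by blast
  have "ev (\<lambda>(i, j). of_real (a i $ j)) e = of_real (p (\<lambda>(i, j). a i $ j))" for a :: "nat \<Rightarrow> real^'a"
    using e(3)[of "\<lambda>(i, j). a i $ j"] by (simp add: case_prod_unfold)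
  then show ?thesis using kp e by (intro exI[of _ k] exI[of _ e]) simp
qed

text \<open>Two demands compete in the choice of new parameters. Equal entries of different points
  must stay equal for the relation to carry over, so replacement is a function of the entry; entries
  that differ at a coordinate in \<open>J\<close> must stay different for the new points to be
  distinct, so there it is injective.\<close>

lemma monochromatic_edge_exists:
  fixes a :: "nat \<Rightarrow> real^'n::finite" and \<psi> :: "real^'n \<Rightarrow> 'c" and K :: "'c set"
  assumes K: "infinite K" and F: "\<rat> \<subseteq> F" and T: "indep F T (\<lambda>x. x)"
    and k: "2 \<le> k" and e: "e \<in> over F ({..<k} \<times> UNIV)"
    and \<psi>: "range \<psi> \<subseteq> K"
    and rep: "\<And>i. i < k \<Longrightarrow> represents F T (a i) D (t i)"
    and J: "J \<subseteq> {..<fst D}" "\<And>n. card J = Suc n \<Longrightarrow> \<not> small K n T"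
    and sepJ: "\<And>i i'. i < k \<Longrightarrow> i' < k \<Longrightarrow> i \<noteq> i' \<Longrightarrow> \<exists>l\<in>J. t i l \<noteq> t i' l"
    and zero: "ev (\<lambda>(i, j). of_real (a i $ j)) e = 0"
  shows "\<exists>b c. inj_on b {..<k} \<and> ev (\<lambda>(i, j). of_real (b i $ j)) e = 0 \<and> (\<forall>i<k. \<psi> (b i) = c)"
proof -
  obtain d q r Q c z where D: "D = (d, q, r, Q, c, z)" by (cases D) auto
  have JD: "J \<subseteq> {..<d}" using J(1) by (simp add: D)
  note rep' = rep[unfolded D represents_def prod.case]
  have k0: "0 < k" using k by simp
  have F1: "{- 1, 0, 1} \<subseteq> F" using F by auto
  have r: "r > 0" and Q: "Q j \<in> over F (insert None (Some ` {..<d}))"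
    and root: "simple_root_on (in_box d q r) (Q j) (c j) (z j)" for j
    using rep'[OF k0] by auto
  have sep: "l = m" if "l < d" "m < d" "\<bar>y - q ! l\<bar> < r" "\<bar>y - q ! m\<bar> < r" for l m and y :: real
    using rep'[OF k0] that by blast
  have dep: "\<exists>u a j. in_box d q r u \<and> in_box d q r (u(l := a)) \<and>
        rt (Q j) (c j) (z j) u \<noteq> rt (Q j) (c j) (z j) (u(l := a))" if "l < d" for l
    using rep'[OF k0] that by blast
  have tT: "t i l \<in> T" and tb: "in_box d q r (\<lambda>l. of_real (t i l))"
    and tinj: "inj_on (t i) {..<d}"
    and rtt: "rt (Q j) (c j) (z j) (\<lambda>l. of_real (t i l)) = of_real (a i $ j)"
    if "i < k" "l < d" for i l j
    using rep'[OF that(1)] that(2) by blast+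
  have tq: "\<bar>t i l - q ! l\<bar> < r" if "i < k" "l < d" for i l
  proof -
    have "cmod (of_real (t i l) - of_real (q ! l)) < r" using tb[OF that] that by (simp add: in_box_def)
    then show ?thesis by (simp flip: of_real_diff)
  qed
  \<comment> \<open>A rational shift, chosen for each position and element, that brings
    \<open>w\<close> into the interval of position \<open>l\<close>.\<close>
  have "\<forall>l w. \<exists>y. y \<in> \<rat> \<and> \<bar>w + y - q ! l\<bar> < r"
  proof (intro allI)
    fix l w
    obtain y where "y \<in> \<rat>" "q ! l - w < y" "y < q ! l - w + r"
      using Rats_dense_in_real[of "q ! l - w" "q ! l - w + r"] r by auto
    then show "\<exists>y. y \<in> \<rat> \<and> \<bar>w + y - q ! l\<bar> < r" by (intro exI[of _ y]) auto
  qed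
  then have "\<exists>\<rho>. \<forall>l w. \<rho> l w \<in> \<rat> \<and> \<bar>w + \<rho> l w - q ! l\<bar> < r" by metis
  then obtain \<rho> where \<rho>: "\<And>l w. \<rho> l w \<in> \<rat>" "\<And>l w. \<bar>w + \<rho> l w - q ! l\<bar> < r" by blast
  define \<theta> where "\<theta> l w = w + \<rho> l w" for l w
  have \<theta>b: "in_box d q r (\<lambda>l. of_real (\<theta> l (w l)))" for w
    unfolding in_box_def
  proof (intro allI impI)
    fix l
    have "cmod (complex_of_real (\<theta> l (w l)) - of_real (q ! l)) = \<bar>\<theta> l (w l) - q ! l\<bar>"
      by (simp flip: of_real_diff)
    then show "cmod (complex_of_real (\<theta> l (w l)) - of_real (q ! l)) < r" using \<rho>(2) by (simp add: \<theta>_def)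
  qed
  define point where "point w = (\<chi> j. Re (rt (Q j) (c j) (z j) (\<lambda>l. of_real (\<theta> l (w l)))))" for w
  have point: "of_real (point w $ j) = rt (Q j) (c j) (z j) (\<lambda>l. of_real (\<theta> l (w l)))" for w j
    using rt_real[OF root \<theta>b] by (simp add: point_def)
  define g where "g v = \<psi> (point (\<lambda>l. if l \<in> J then v l else t 0 l))" for v
  have finJ: "finite J" using JD finite_subset by blast
  have "J \<noteq> {}" using sepJ[of 0 1] k by auto
  then obtain n where n: "card J = Suc n" using finJ by (metis card_eq_0_iff not0_implies_Suc)
  \<comment> \<open>The \<open>k\<close> points have at most \<open>k\<close> different entries at a
    position, so sides with \<open>k\<close> elements suffice. The entries of \<open>t 0\<close> are
    avoided because some of them remain as frozen coordinates.\<close>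
  have "\<exists>A. \<exists>m\<in>K. (\<forall>l\<in>J. A l \<subseteq> T - t 0 ` {..<d} \<and> finite (A l) \<and> card (A l) = k) \<and>
     disjoint_family_on A J \<and> (\<forall>v. (\<forall>l\<in>J. v l \<in> A l) \<longrightarrow> g v = m)"
  proof (rule not_small_grid[OF K J(2)[OF n] finJ n])
    show "g v \<in> K" for v using \<psi> by (auto simp: g_def)
    show "g v = g v'" if "\<forall>l\<in>J. v l = v' l" for v v'
    proof -
      have "(\<lambda>l. if l \<in> J then v l else t 0 l) = (\<lambda>l. if l \<in> J then v' l else t 0 l)"
        using that by auto
      then show ?thesis by (simp only: g_def)
    qed
  qed simp
  then obtain A m where
    A': "(\<forall>l\<in>J. A l \<subseteq> T - t 0 ` {..<d} \<and> finite (A l) \<and> card (A l) = k) \<and>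
     disjoint_family_on A J \<and> (\<forall>v. (\<forall>l\<in>J. v l \<in> A l) \<longrightarrow> g v = m)" by (elim exE bexE)
  have A: "\<And>l. l \<in> J \<Longrightarrow> A l \<subseteq> T - t 0 ` {..<d} \<and> finite (A l) \<and> card (A l) = k"
    "disjoint_family_on A J" "\<And>v. \<forall>l\<in>J. v l \<in> A l \<Longrightarrow> g v = m"
    using A' by blast+
  have "\<exists>\<iota>. inj_on \<iota> ((\<lambda>i. t i l) ` {..<k}) \<and> \<iota> ` ((\<lambda>i. t i l) ` {..<k}) \<subseteq> A l" if "l \<in> J" for l
  proof -
    have "card ((\<lambda>i. t i l) ` {..<k}) \<le> card (A l)"
      using card_image_le[of "{..<k}" "\<lambda>i. t i l"] A(1)[OF that] by simp
    then show ?thesis using card_le_inj[of "(\<lambda>i. t i l) ` {..<k}" "A l"] A(1)[OF that] by blast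
  qed
  then have "\<forall>l\<in>J. \<exists>\<iota>. inj_on \<iota> ((\<lambda>i. t i l) ` {..<k}) \<and> \<iota> ` ((\<lambda>i. t i l) ` {..<k}) \<subseteq> A l" by blast
  from bchoice[OF this] obtain \<iota> where
    \<iota>: "\<And>l. l \<in> J \<Longrightarrow> inj_on (\<iota> l) ((\<lambda>i. t i l) ` {..<k})"
      "\<And>l i. l \<in> J \<Longrightarrow> i < k \<Longrightarrow> \<iota> l (t i l) \<in> A l" by blast
  define \<kappa> where "\<kappa> l w = (if l \<in> J then \<iota> l w else t 0 l)" for l w
  define y where "y i l = \<kappa> l (t i l)" for i l
  define b where "b i = point (y i)" for i
  have "\<psi> (b i) = m" if "i < k" for i
  proof -
    have "g (y i) = m" by (rule A(3)) (use \<iota>(2) that in \<open>simp add: y_def \<kappa>_def\<close>)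
    moreover have "(\<lambda>l. if l \<in> J then y i l else t 0 l) = y i" by (auto simp: y_def \<kappa>_def)
    ultimately show ?thesis by (simp add: g_def b_def)
  qed
  moreover have "ev (\<lambda>(i, j). of_real (b i $ j)) e = 0"
  proof -
    \<comment> \<open>The new value must be a function of the entry alone, but the replacement and
      the shift depend on its position. The position is recovered from the interval that contains
      the entry.\<close>
    define ix where "ix w = (THE l. l < d \<and> \<bar>w - q ! l\<bar> < r)" for w
    have ix: "ix (t i l) = l" if "i < k" "l < d" for i l
      unfolding ix_def by (rule the_equality) (use tq that sep in blast)+
    define u where "u w = complex_of_real (\<theta> (ix w) (\<kappa> (ix w) w))" for w
    have u: "u (t i l) = of_real (\<theta> l (y i l))" if "i < k" "l < d" for i l
      by (simp add: u_def ix[OF that] y_def)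
    have "ev (\<lambda>(i, j). rt (Q j) (c j) (z j) (\<lambda>l. u (t i l))) e = 0"
    proof (rule root_identity[OF F1 Q root e T])
      show "t i l \<in> T" if "i < k" "l < d" for i l by (rule tT[OF that])
      show "in_box d q r (\<lambda>l. of_real (t i l))" if "i < k" for i
        using rep'[OF that] by blast
      have "ev (\<lambda>(i, j). rt (Q j) (c j) (z j) (\<lambda>l. of_real (t i l))) e = ev (\<lambda>(i, j). of_real (a i $ j)) e"
        by (rule ev_cong[OF e]) (use rep' in auto)
      then show "ev (\<lambda>(i, j). rt (Q j) (c j) (z j) (\<lambda>l. of_real (t i l))) e = 0" using zero by simp
      show "in_box d q r (\<lambda>l. u (t i l))" if "i < k" for i
        using \<theta>b[of "y i"] u[OF that] by (simp add: in_box_def)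
    qed
    moreover have "ev (\<lambda>(i, j). rt (Q j) (c j) (z j) (\<lambda>l. u (t i l))) e = ev (\<lambda>(i, j). of_real (b i $ j)) e"
    proof (rule ev_cong[OF e])
      fix v assume "v \<in> {..<k} \<times> (UNIV :: 'n set)"
      then obtain i j where v: "v = (i, j)" "i < k" by auto
      have "rt (Q j) (c j) (z j) (\<lambda>l. u (t i l)) = of_real (b i $ j)"
        unfolding b_def point by (rule rt_cong[OF Q]) (rule u[OF v(2)])
      then show "(\<lambda>(i, j). rt (Q j) (c j) (z j) (\<lambda>l. u (t i l))) v = (\<lambda>(i, j). of_real (b i $ j)) v"
        by (simp add: v)
    qed
    ultimately show ?thesis by simp
  qed
  moreover have "b i \<noteq> b i'" if ii: "i < k" "i' < k" "i \<noteq> i'" for i i'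
  proof -
    obtain l0 where l0: "l0 \<in> J" "t i l0 \<noteq> t i' l0" using sepJ[OF ii] by blast
    have l0d: "l0 < d" using l0 JD by auto
    have yl0: "y i l0 \<noteq> y i' l0"
    proof
      assume "y i l0 = y i' l0"
      then have "\<iota> l0 (t i l0) = \<iota> l0 (t i' l0)" using l0 by (simp add: y_def \<kappa>_def)
      then have "t i l0 = t i' l0" using inj_onD[OF \<iota>(1)[OF l0(1)]] ii by blast
      with l0 show False by simp
    qed
    have yJ: "y h l \<in> A l" if "h < k" "l \<in> J" for h l using \<iota>(2) that by (simp add: y_def \<kappa>_def)
    have yn: "y h l = t 0 l" if "l \<notin> J" for h l using that by (simp add: y_def \<kappa>_def)
    have yT: "y h l \<in> T" if "h < k" "l < d" for h l
    proof (cases "l \<in> J")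
      case True
      then show ?thesis using yJ[OF that(1) True] A(1)[OF True] by blast
    next
      case False
      then show ?thesis using yn tT[OF k0 that(2)] by simp
    qed
    have ysep: "l = l'" if "h < k" "h' < k" "l < d" "l' < d" "y h l = y h' l'" for h h' l l'
    proof -
      consider "l \<in> J" "l' \<in> J" | "l \<in> J" "l' \<notin> J" | "l \<notin> J" "l' \<in> J" | "l \<notin> J" "l' \<notin> J" by blast
      then show ?thesis
      proof cases
        case 1
        then show ?thesis using A(2) yJ[OF that(1)] yJ[OF that(2)] that(5)
          unfolding disjoint_family_on_def by (metis disjoint_iff)
      next
        case 2
        then have "y h' l' \<in> t 0 ` {..<d}" using yn that(4) by auto
        then show ?thesis using yJ[OF that(1) 2(1)] A(1)[OF 2(1)] that(5) by auto
      next
        case 3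
        then have "y h l \<in> t 0 ` {..<d}" using yn that(3) by auto
        then show ?thesis using yJ[OF that(2) 3(2)] A(1)[OF 3(2)] that(5) by auto
      next
        case 4
        then have "t 0 l = t 0 l'" using that(5) yn by simp
        then show ?thesis using tinj[OF k0 that(3)] that(3,4) by (auto simp: inj_on_def)
      qed
    qed
    \<comment> \<open>With pairs of position and entry as names, the shift is a function of the name
      and no name occurs at two positions. Distinct names still carry distinct elements of
      \<open>T\<close> by \<open>ysep\<close>, so the shifted family is independent.\<close>
    define W where "W = (\<lambda>(h, l). (l, y h l)) ` ({i, i'} \<times> {..<d})"
    have "indep F W ((\<lambda>x. x) \<circ> snd)"
    proof (rule indep_reindex[OF T])
      show "snd ` W \<subseteq> T" using yT ii by (auto simp: W_def)
      show "inj_on snd W" using ysep ii by (auto simp: W_def inj_on_def)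
    qed
    then have "indep F W (\<lambda>w. ((\<lambda>x. x) \<circ> snd) w + \<rho> (fst w) (snd w))"
      by (rule indep_translate) (use \<rho>(1) F in blast)
    then have indW: "indep F W (\<lambda>w. \<theta> (fst w) (snd w))" by (simp add: \<theta>_def)
    obtain v x j0 where vx: "in_box d q r v" "in_box d q r (v(l0 := x))"
      "rt (Q j0) (c j0) (z j0) v \<noteq> rt (Q j0) (c j0) (z j0) (v(l0 := x))"
      using dep[OF l0d] by blast
    have "\<exists>j. rt (Q j) (c j) (z j) (\<lambda>l. of_real (\<theta> (fst (l, y i l)) (snd (l, y i l)))) \<noteq>
        rt (Q j) (c j) (z j) (\<lambda>l. of_real (\<theta> (fst (l, y i' l)) (snd (l, y i' l))))"
    proof (rule root_tuples_distinct[where \<sigma> = "\<lambda>l. (l, y i l)" and \<sigma>' = "\<lambda>l. (l, y i' l)"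
          and \<omega> = "\<lambda>w. \<theta> (fst w) (snd w)", OF F1 Q root indW])
      show "(l, y i l) \<in> W" "(l, y i' l) \<in> W" if "l < d" for l using that by (auto simp: W_def)
      show "in_box d q r (\<lambda>l. of_real (\<theta> (fst (l, y i l)) (snd (l, y i l))))"
        "in_box d q r (\<lambda>l. of_real (\<theta> (fst (l, y i' l)) (snd (l, y i' l))))"
        using \<theta>b[of "y i"] \<theta>b[of "y i'"] by simp_all
      show "l = m" if "(l, y i l) = (m, y i m) \<or> (l, y i' l) = (m, y i' m) \<or> (l, y i l) = (m, y i' m)" for l m
        using that by blast
      show "(l0, y i l0) \<noteq> (l0, y i' l0)" using yl0 by simp
    qed (rule l0d vx)+
    then obtain j where "complex_of_real (b i $ j) \<noteq> of_real (b i' $ j)"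
      unfolding b_def point by auto
    then show ?thesis by auto
  qed
  then have "inj_on b {..<k}" by (auto simp: inj_on_def)
  ultimately show ?thesis by blast
qed

section \<open>Assembly of the colouring\<close>

theorem theorem2p5:
  fixes \<H> :: "(real^'n::finite) set set set"
    and K :: "'c set"
  assumes "(card_of (UNIV :: nat set), card_of K) \<in> ordLeq"
    and "(card_of K, card_of (Pow (UNIV :: nat set))) \<in> ordLeq"
    and "\<forall>E\<in>\<H>. algebraic_hypergraph E"
    and "(card_of \<H>, card_of K) \<in> ordLeq"
    and "\<forall>E\<in>\<H>. \<exists>\<psi> :: real^'n \<Rightarrow> 'c. range \<psi> \<subseteq> K \<and> proper_coloring \<psi> E"
  shows "\<exists>\<phi> :: real^'n \<Rightarrow> 'c. range \<phi> \<subseteq> K \<and> (\<forall>E\<in>\<H>. proper_coloring \<phi> E)"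
proof -
  have K: "infinite K"
    using assms(1) by (simp add: infinite_le_lepoll lepoll_iff_ordLeq)
  have "\<forall>E\<in>\<H>. \<exists>k e. 2 \<le> k \<and> finite (csts e) \<and> pvars e \<subseteq> {..<k} \<times> UNIV \<and>
     E = {S. \<exists>a :: nat \<Rightarrow> real^'n. inj_on a {..<k} \<and> S = a ` {..<k} \<and>
           ev (\<lambda>(i, j). of_real (a i $ j)) e = 0}"
    using assms(3) algebraic_hypergraph_pexpr by blast
  from bchoice[OF this] obtain k where "\<forall>E\<in>\<H>. \<exists>e. 2 \<le> k E \<and> finite (csts e) \<and> pvars e \<subseteq> {..<k E} \<times> UNIV \<and>
     E = {S. \<exists>a :: nat \<Rightarrow> real^'n. inj_on a {..<k E} \<and> S = a ` {..<k E} \<and>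
           ev (\<lambda>(i, j). of_real (a i $ j)) e = 0}" ..
  from bchoice[OF this] obtain e where e: "\<forall>E\<in>\<H>. 2 \<le> k E \<and> finite (csts (e E)) \<and>
     pvars (e E) \<subseteq> {..<k E} \<times> UNIV \<and>
     E = {S. \<exists>a :: nat \<Rightarrow> real^'n. inj_on a {..<k E} \<and> S = a ` {..<k E} \<and>
           ev (\<lambda>(i, j). of_real (a i $ j)) (e E) = 0}" ..
  define F where "F = \<rat> \<union> (\<Union>E\<in>\<H>. csts (e E))"
  have F: "\<rat> \<subseteq> F" by (simp add: F_def)
  have "(\<Union>E\<in>\<H>. csts (e E)) \<lesssim> K"
  proof (rule UN_lepoll_infinite[OF K])
    show "\<H> \<lesssim> K" using assms(4) by (simp add: lepoll_iff_ordLeq)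
    show "csts (e E) \<lesssim> K" if "E \<in> \<H>" for E
      by (rule countable_lepoll_infinite[OF K countable_finite]) (use e that in blast)
  qed
  moreover have RK: "(\<rat> :: real set) \<lesssim> K" by (rule countable_lepoll_infinite[OF K countable_rat])
  ultimately have FK: "F \<lesssim> K" unfolding F_def by (intro Un_lepoll_infinite[OF K])
  obtain T where T: "indep F T (\<lambda>x. x)" "\<And>x. \<exists>W. finite W \<and> W \<subseteq> T \<and> algebraic_over F W x"
    using transcendence_basis_exists[OF F] by blast
  have "\<forall>x :: real^'n. \<exists>D t. represents F T x D t" using represents_exists[OF F T(2)] by blast
  from choice[OF this] obtain D where "\<forall>x :: real^'n. \<exists>t. represents F T x (D x) t" ..
  from choice[OF this] obtain t where rep: "\<forall>x :: real^'n. represents F T x (D x) (t x)" ..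
  obtain \<phi> J where \<phi>J: "\<forall>d :: nat.
     (\<forall>x. (\<forall>l<d. x l \<in> T) \<longrightarrow> \<phi> d x \<in> K) \<and>
     (\<forall>c. J d c \<subseteq> {..<d} \<and> (\<forall>n. card (J d c) = Suc n \<longrightarrow> \<not> small K n T)) \<and>
     (\<forall>x y. (\<forall>l<d. x l \<in> T) \<longrightarrow> (\<forall>l<d. y l \<in> T) \<longrightarrow> \<phi> d x = \<phi> d y \<longrightarrow>
        (\<forall>l\<in>J d (\<phi> d x). x l = y l) \<longrightarrow> (\<forall>l<d. x l = y l))"
    using grid_determining_coloring[OF K, of T] by (elim exE) (rule that)
  \<comment> \<open>\<open>T\<close> may have more than \<open>|K|\<close> elements, so the tuple of
    parameters cannot be part of a colour; it enters only through \<open>\<phi>\<close>.\<close>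
  let ?Data = "(UNIV :: nat set) \<times> lists (\<rat> :: real set) \<times> (\<rat> :: real set) \<times>
     {Q :: 'n \<Rightarrow> nat option pexpr. range Q \<subseteq> over F UNIV} \<times>
     {c :: 'n \<Rightarrow> real. range c \<subseteq> \<rat>} \<times> {z :: 'n \<Rightarrow> real. range z \<subseteq> \<rat>}"
  have "?Data \<times> K \<lesssim> K"
    by (intro Times_lepoll_infinite[OF K] lists_lepoll_infinite[OF K RK] RK lepoll_refl
        finite_funs_lepoll_infinite[OF K] over_lepoll[OF K FK] countable_lepoll_infinite[OF K])
      auto
  then obtain h where h: "inj_on h (?Data \<times> K)" "h ` (?Data \<times> K) \<subseteq> K" unfolding lepoll_def by blast
  define d where "d x = fst (D x)" for x
  define col where "col x = h (D x, \<phi> (d x) (t x))" for x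
  have tT: "\<forall>l<d x. t x l \<in> T" for x
    using rep[rule_format, of x] by (cases "D x") (auto simp: represents_def d_def)
  have inC: "(D x, \<phi> (d x) (t x)) \<in> ?Data \<times> K" for x
  proof -
    have "D x \<in> ?Data"
      using rep[rule_format, of x] by (cases "D x") (auto simp: represents_def over_def)
    moreover have "\<phi> (d x) (t x) \<in> K" using \<phi>J tT by blast
    ultimately show ?thesis by blast
  qed
  have "proper_coloring col E" if E: "E \<in> \<H>" for E
  proof (rule ccontr)
    assume "\<not> proper_coloring col E"
    then obtain S where S: "S \<in> E" "\<And>x y. x \<in> S \<Longrightarrow> y \<in> S \<Longrightarrow> col x = col y"
      unfolding proper_coloring_def by blast
    have eE: "2 \<le> k E" "pvars (e E) \<subseteq> {..<k E} \<times> UNIV"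
      "E = {S. \<exists>a :: nat \<Rightarrow> real^'n. inj_on a {..<k E} \<and> S = a ` {..<k E} \<and>
           ev (\<lambda>(i, j). of_real (a i $ j)) (e E) = 0}"
      using e E by blast+
    obtain a where a: "inj_on a {..<k E}" "S = a ` {..<k E}" "ev (\<lambda>(i, j). of_real (a i $ j)) (e E) = 0"
      using S(1) eE(3) by blast
    have k0: "0 < k E" using eE(1) by simp
    obtain \<psi> :: "real^'n \<Rightarrow> 'c" where \<psi>: "range \<psi> \<subseteq> K" "proper_coloring \<psi> E" using assms(5) E by blast
    have same: "D (a i) = D (a 0)" "\<phi> (d (a i)) (t (a i)) = \<phi> (d (a 0)) (t (a 0))" if "i < k E" for i
    proof -
      have "col (a i) = col (a 0)" using S(2) a(2) that k0 by blast
      then have "(D (a i), \<phi> (d (a i)) (t (a i))) = (D (a 0), \<phi> (d (a 0)) (t (a 0)))"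
        unfolding col_def by (rule inj_onD[OF h(1) _ inC inC])
      then show "D (a i) = D (a 0)" "\<phi> (d (a i)) (t (a i)) = \<phi> (d (a 0)) (t (a 0))" by auto
    qed
    have d_same: "d (a i) = d (a 0)" if "i < k E" for i using same[OF that] by (simp add: d_def)
    define I where "I = J (d (a 0)) (\<phi> (d (a 0)) (t (a 0)))"
    have "\<exists>b c. inj_on b {..<k E} \<and> ev (\<lambda>(i, j). of_real (b i $ j)) (e E) = 0 \<and> (\<forall>i<k E. \<psi> (b i) = c)"
    proof (rule monochromatic_edge_exists[OF K F T(1) eE(1) _ \<psi>(1), where D = "D (a 0)" and t = "\<lambda>i. t (a i)" and J = I])
      have "csts (e E) \<subseteq> F" using E by (auto simp: F_def)
      then show "e E \<in> over F ({..<k E} \<times> UNIV)" using eE(2) by (simp add: over_def)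
      show "represents F T (a i) (D (a 0)) (t (a i))" if "i < k E" for i
        using rep same(1)[OF that] by metis
      show "I \<subseteq> {..<fst (D (a 0))}" using \<phi>J unfolding I_def d_def by blast
      show "\<not> small K n T" if "card I = Suc n" for n using \<phi>J that unfolding I_def by blast
      show "ev (\<lambda>(i, j). of_real (a i $ j)) (e E) = 0" by (rule a(3))
      \<comment> \<open>Tuples of one colour that agree on the named coordinates are equal, and
        together with equal data this makes the two points of the edge equal.\<close>
      show "\<exists>l\<in>I. t (a i) l \<noteq> t (a i') l" if ii: "i < k E" "i' < k E" "i \<noteq> i'" for i i'
      proof (rule ccontr)
        assume "\<not> ?thesis"
        then have "\<forall>l\<in>J (d (a 0)) (\<phi> (d (a 0)) (t (a i))). t (a i) l = t (a i') l"
          using same(2)[OF ii(1)] d_same[OF ii(1)] by (simp add: I_def)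
        moreover have "\<phi> (d (a 0)) (t (a i)) = \<phi> (d (a 0)) (t (a i'))"
          using same(2)[OF ii(1)] same(2)[OF ii(2)] d_same[OF ii(1)] d_same[OF ii(2)] by simp
        moreover have "\<forall>l<d (a 0). t (a i) l \<in> T" "\<forall>l<d (a 0). t (a i') l \<in> T"
          using tT[of "a i"] tT[of "a i'"] d_same[OF ii(1)] d_same[OF ii(2)] by auto
        ultimately have eq: "\<forall>l<d (a 0). t (a i) l = t (a i') l" using \<phi>J by blast
        obtain d' q r Q c z where D0: "D (a 0) = (d', q, r, Q, c, z)" by (cases "D (a 0)") auto
        have r1: "represents F T (a i) (d', q, r, Q, c, z) (t (a i))"
          using rep same(1)[OF ii(1)] D0 by metis
        have r2: "represents F T (a i') (d', q, r, Q, c, z) (t (a i'))"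
          using rep same(1)[OF ii(2)] D0 by metis
        have "complex_of_real (a i $ j) = of_real (a i' $ j)" for j
        proof -
          have "of_real (a i $ j) = rt (Q j) (c j) (z j) (\<lambda>l. of_real (t (a i) l))"
            using r1 by (simp add: represents_def)
          also have "\<dots> = rt (Q j) (c j) (z j) (\<lambda>l. of_real (t (a i') l))"
          proof (rule rt_cong)
            show "Q j \<in> over F (insert None (Some ` {..<d'}))" using r1 by (simp add: represents_def)
            show "complex_of_real (t (a i) l) = of_real (t (a i') l)" if "l < d'" for l
              using eq that D0 by (simp add: d_def)
          qed
          also have "\<dots> = of_real (a i' $ j)" using r2 by (simp add: represents_def)
          finally show ?thesis .
        qed
        then have "a i = a i'" by (simp add: vec_eq_iff)
        then show False using a(1) ii by (auto simp: inj_on_def)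
      qed
    qed
    then obtain b c where b: "inj_on b {..<k E}" "ev (\<lambda>(i, j). of_real (b i $ j)) (e E) = 0" "\<forall>i<k E. \<psi> (b i) = c"
      by blast
    have "b ` {..<k E} \<in> E" using b(1,2) by (subst eE(3)) blast
    then obtain x y where "x \<in> b ` {..<k E}" "y \<in> b ` {..<k E}" "\<psi> x \<noteq> \<psi> y"
      using \<psi>(2) unfolding proper_coloring_def by blast
    then show False using b(3) by auto
  qed
  moreover have "range col \<subseteq> K" using h(2) inC by (auto simp: col_def)
  ultimately show ?thesis by blast
qed

end
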